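(* Let $M_n$ be an $n\times n$ random matrix whose entries are independent random variables, each equal to $+1$ or $-1$ with probability $1/2$. Let $h(x) := x\log_2\frac{1}{x} + (1-x)\log_2\frac{1}{1-x}$ and let $\varepsilon = 0.06191\ldots$ be the unique solution in $(0,1/2)$ of $$h(\varepsilon) + \frac{\varepsilon}{\log_2(16/15)} = 1.$$ Then $\mathbf{P}(\det M_n = 0) \le (1-\varepsilon + o(1))^n$, where $o(1)\to 0$ as $n\to\infty$. *)

theory Defs
  imports "HOL-Probability.Probability" "Jordan_Normal_Form.Determinant"
begin

definition binary_entropy :: "real \<Rightarrow> real" where
  "binary_entropy x = x * log 2 (1 / x) + (1 - x) * log 2 (1 / (1 - x))"

text \<open>Both \<^term>\<open>1::real\<close> and \<^term>\<open>- 1::real\<close> have mass one half, so the entries are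
  signs almost surely; independence is joint over all \<open>n * n\<close> entries and includes
  their measurability.\<close>

definition random_sign_matrix :: "'a measure \<Rightarrow> nat \<Rightarrow> ('a \<Rightarrow> real mat) \<Rightarrow> bool" where
  "random_sign_matrix \<Omega> n M \<longleftrightarrow>
     prob_space \<Omega> \<and>
     (\<forall>\<omega>\<in>space \<Omega>. M \<omega> \<in> carrier_mat n n) \<and>
     prob_space.indep_vars \<Omega> (\<lambda>_. borel) (\<lambda>ij \<omega>. M \<omega> $$ ij) ({0..<n} \<times> {0..<n}) \<and>
     (\<forall>i<n. \<forall>j<n. measure \<Omega> {\<omega> \<in> space \<Omega>. M \<omega> $$ (i, j) = 1} = 1 / 2 \<and>
                   measure \<Omega> {\<omega> \<in> space \<Omega>. M \<omega> $$ (i, j) = - 1} = 1 / 2)"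

definition solves_entropy_equation :: "real \<Rightarrow> bool" where
  "solves_entropy_equation \<epsilon> \<longleftrightarrow>
     0 < \<epsilon> \<and> \<epsilon> < 1 / 2 \<and> binary_entropy \<epsilon> + \<epsilon> / log 2 (16 / 15) = 1"

end

theory Submission
  imports Defs "HOL-Number_Theory.Cong" "HOL-Real_Asymp.Real_Asymp"
begin

text \<open>
  We show \<open>P (det M = 0) \<le> 3 n (15/16)^n\<close> for large \<open>n\<close>, which suffices because \<open>\<epsilon> < 1/16\<close>.

  If \<open>M\<close> is singular, some row is orthogonal to every vector that is orthogonal to all the other
  rows. By Siegel's lemma such a vector \<open>v\<close> can be chosen integral with \<open>\<bar>v\<^sub>i\<bar> \<le> (2n+1)^n\<close>,
  depending on the other rows only. Let \<open>\<rho> = P (x \<bullet> v = 0)\<close> for a random sign vector \<open>x\<close>. If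
  \<open>\<rho> \<le> (15/16)^n\<close>, the last row costs at most this much. Otherwise the structure of \<open>v\<close> is
  exploited by a union bound: by Chebyshev's estimates and the size of \<open>v\<close> there is a prime
  \<open>p\<close> of order \<open>n^(6/5) / \<rho>\<close> (of order \<open>n^2\<close> if \<open>\<rho> \<ge> 2 n^(-9/20)\<close>) for which the concentration of \<open>x \<bullet> v\<close> modulo \<open>p\<close> is still of
  order \<open>\<rho>\<close>, and it remains to show that few residue vectors modulo \<open>p\<close> are that concentrated.

  For the count, \<open>|cos x| \<le> 3/4 + cos (2x) / 4\<close> replaces the signs by lazy steps, which stay put with
  probability \<open>3/4\<close>, so that the return probability \<open>r\<close> of the walk becomes the value at \<open>0\<close> of a
  positive definite function. Choosing the coordinates of the residue vector one after another, each
  step either makes \<open>r\<close> drop by a fixed factor, which can happen at most \<open>n/4\<close> times, or the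
  coordinate lies in a set of residues where that function is nearly maximal. Repeated sums of such a
  set grow linearly modulo \<open>p\<close>, so it is smaller than \<open>1/r\<close> by a power of \<open>n\<close>; this gain
  outweighs the factor \<open>n^(6/5)\<close> lost in the choice of \<open>p\<close>.
\<close>

section \<open>The entropy equation\<close>

definition entropy_sum :: "real \<Rightarrow> real" where
  "entropy_sum x = binary_entropy x + x / log 2 (16 / 15)"

lemma entropy_sum_eq:
  assumes "0 < x" "x < 1"
  shows "entropy_sum x = (- x * ln x - (1 - x) * ln (1 - x)) / ln 2 + x * ln 2 / ln (16 / 15)"
  using assms by (simp add: entropy_sum_def binary_entropy_def log_def ln_div field_simps)

lemma entropy_sum_deriv:
  assumes "0 < x" "x < 1"
  shows "(entropy_sum has_real_derivative (ln (1 - x) - ln x) / ln 2 + ln 2 / ln (16 / 15)) (at x)"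
proof -
  have "((\<lambda>x. (- x * ln x - (1 - x) * ln (1 - x)) / ln 2 + x * ln 2 / ln (16 / 15)) has_real_derivative
      (ln (1 - x) - ln x) / ln 2 + ln 2 / ln (16 / 15)) (at x)"
  proof -
    have "((\<lambda>x. - x * ln x - (1 - x) * ln (1 - x)) has_real_derivative ln (1 - x) - ln x) (at x)"
      using assms by (auto intro!: derivative_eq_intros)
    then have "((\<lambda>x. (- x * ln x - (1 - x) * ln (1 - x)) / ln 2) has_real_derivative (ln (1 - x) - ln x) / ln 2) (at x)"
      by (rule DERIV_cdivide)
    moreover have "((\<lambda>x. x * ln 2 / ln (16 / 15)) has_real_derivative ln 2 / ln (16 / 15)) (at x)"
      by (rule DERIV_cdivide) (auto intro!: derivative_eq_intros)
    ultimately show ?thesis by (rule DERIV_add)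
  qed
  moreover have "\<forall>\<^sub>F y in nhds x. (- y * ln y - (1 - y) * ln (1 - y)) / ln 2 + y * ln 2 / ln (16 / 15) = entropy_sum y"
  proof -
    have "\<forall>\<^sub>F y in nhds x. y \<in> {0<..<1}" using assms by (intro eventually_nhds_in_open) auto
    then show ?thesis by eventually_elim (simp add: entropy_sum_eq)
  qed
  ultimately show ?thesis using DERIV_cong_ev[OF refl _ refl] by fast
qed

text \<open>Below \<open>1 / 2\<close> one has \<open>ln z < ln (1 - z)\<close>, so both terms of
  the derivative are positive.\<close>

lemma entropy_sum_strict_mono:
  assumes "0 < x" "x < y" "y < 1 / 2"
  shows "entropy_sum x < entropy_sum y"
proof (rule DERIV_pos_imp_increasing[OF assms(2)])
  fix z assume z: "x \<le> z" "z \<le> y"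
  have "ln z < ln (1 - z)" using z assms by (subst ln_less_cancel_iff) auto
  then have "(ln (1 - z) - ln z) / ln 2 + ln 2 / ln (16 / 15) > 0" by (intro add_pos_pos divide_pos_pos) auto
  then show "\<exists>d. (entropy_sum has_real_derivative d) (at z) \<and> 0 < d"
    using entropy_sum_deriv[of z] z assms by (intro exI conjI) auto
qed

section \<open>Numerical bracketing of the root\<close>

lemma ln_2_bounds: "693147 / 1000000 \<le> ln (2 :: real)" "ln (2 :: real) \<le> 693148 / 1000000"
  using ln_approx_bounds[of 2 6] by (simp_all add: eval_nat_numeral field_simps)

lemma ln_16_15_bounds: "645385 / 10000000 \<le> ln (16 / 15 :: real)" "ln (16 / 15 :: real) \<le> 645386 / 10000000"
  using ln_approx_bounds[of "16 / 15" 3] by (simp_all add: eval_nat_numeral field_simps)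

text \<open>Both brackets lie near \<open>1 / 16\<close>, where the logarithms are small perturbations of
  \<open>- 4 * ln 2\<close> and \<open>- ln (16 / 15)\<close>.\<close>
lemma entropy_sum_near_sixteenth:
  assumes "0 < x" "x < 1"
  shows "entropy_sum x = 4 * x + (x * ln (1 / (16 * x)) + (1 - x) * (ln (16 / 15) - ln ((1 - x) * 16 / 15))) / ln 2
           + x * ln 2 / ln (16 / 15)"
proof -
  have "ln (16 :: real) = 4 * ln 2" using ln_realpow[of 2 4] by simp
  then have "ln x = - 4 * ln 2 - ln (1 / (16 * x))" using assms by (simp add: ln_div ln_mult)
  moreover have "ln (1 - x) = ln ((1 - x) * 16 / 15) - ln (16 / 15)"
    using assms ln_mult[of "1 - x" "16 / 15"] by simp
  ultimately have "- x * ln x - (1 - x) * ln (1 - x) = 4 * x * ln 2 + (x * ln (1 / (16 * x)) + (1 - x) * (ln (16 / 15) - ln ((1 - x) * 16 / 15)))"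
    by (simp only:) (simp add: algebra_simps)
  then show ?thesis using assms by (simp add: entropy_sum_eq add_divide_distrib)
qed

text \<open>Near the root the slope is about 15, so over a bracket of width
  \<open>1 / 100000\<close> the sum changes by only about 0.00015; hence the many digits in the
  bounds for \<open>ln 2\<close> and \<open>ln (16 / 15)\<close>.\<close>

lemma entropy_sum_lower_end: "entropy_sum (6191 / 100000) < 1"
proof -
  let ?a = "6191 / 100000 :: real"
  have "ln (1 / (16 * ?a)) \<le> 1 / (16 * ?a) - 1" by (rule ln_le_minus_one) simp
  then have s: "ln (1 / (16 * ?a)) \<le> 9530 / 1000000" by simp
  \<comment> \<open>The constant truncates \<open>(1 - ?a) * 16 / 15\<close>, which is
    1.00062933...; the quadratic lower bound for the logarithm then loses less than one
    millionth.\<close>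
  have "ln (1 + 6293 / 10000000 :: real) \<ge> 6293 / 10000000 - (6293 / 10000000)\<^sup>2"
    by (rule ln_one_plus_pos_lower_bound) auto
  moreover have "ln (1 + 6293 / 10000000 :: real) \<le> ln ((1 - ?a) * 16 / 15)"
    by (subst ln_le_cancel_iff) auto
  moreover have "(6289 / 10000000 :: real) \<le> 6293 / 10000000 - (6293 / 10000000)\<^sup>2" by (simp add: power2_eq_square)
  ultimately have w: "ln ((1 - ?a) * 16 / 15) \<ge> 6289 / 10000000" by linarith
  have "(?a * ln (1 / (16 * ?a)) + (1 - ?a) * (ln (16 / 15) - ln ((1 - ?a) * 16 / 15))) / ln 2 \<le>
      (?a * (9530 / 1000000) + (1 - ?a) * (645386 / 10000000 - 6289 / 10000000)) / (693147 / 1000000)"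
    using s w ln_16_15_bounds ln_2_bounds by (intro frac_le add_mono mult_left_mono diff_mono) auto
  moreover have "?a * ln 2 / ln (16 / 15) \<le> ?a * (693148 / 1000000) / (645385 / 10000000)"
    using ln_16_15_bounds ln_2_bounds by (intro frac_le mult_left_mono) auto
  ultimately have "entropy_sum ?a \<le> 4 * ?a + (?a * (9530 / 1000000) + (1 - ?a) * (645386 / 10000000 - 6289 / 10000000)) / (693147 / 1000000)
      + ?a * (693148 / 1000000) / (645385 / 10000000)"
    by (subst entropy_sum_near_sixteenth, simp, simp) (intro add_mono order_refl)
  also have "\<dots> < 1" by simp
  finally show ?thesis .
qed

lemma entropy_sum_upper_end: "entropy_sum (6192 / 100000) > 1"
proof -
  let ?a = "6192 / 100000 :: real"
  \<comment> \<open>The constant truncates \<open>1 / (16 * ?a)\<close>, which is 1.0093669...; all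
    estimates now point the other way.\<close>
  have "ln (1 + 93669 / 10000000 :: real) \<ge> 93669 / 10000000 - (93669 / 10000000)\<^sup>2"
    by (rule ln_one_plus_pos_lower_bound) auto
  moreover have "ln (1 + 93669 / 10000000 :: real) \<le> ln (1 / (16 * ?a))"
    by (subst ln_le_cancel_iff) auto
  moreover have "(92791 / 10000000 :: real) \<le> 93669 / 10000000 - (93669 / 10000000)\<^sup>2" by (simp add: power2_eq_square)
  ultimately have s: "ln (1 / (16 * ?a)) \<ge> 92791 / 10000000" by linarith
  have "ln ((1 - ?a) * 16 / 15) \<le> (1 - ?a) * 16 / 15 - 1" by (rule ln_le_minus_one) simp
  then have w: "ln ((1 - ?a) * 16 / 15) \<le> 6187 / 10000000" by simp
  have "(?a * (92791 / 10000000) + (1 - ?a) * (645385 / 10000000 - 6187 / 10000000)) / (693148 / 1000000) \<le>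
     (?a * ln (1 / (16 * ?a)) + (1 - ?a) * (ln (16 / 15) - ln ((1 - ?a) * 16 / 15))) / ln 2"
    using s w ln_16_15_bounds ln_2_bounds by (intro frac_le add_mono mult_left_mono diff_mono) auto
  moreover have "?a * (693147 / 1000000) / (645386 / 10000000) \<le> ?a * ln 2 / ln (16 / 15)"
    using ln_16_15_bounds ln_2_bounds by (intro frac_le mult_left_mono) auto
  ultimately have "4 * ?a + (?a * (92791 / 10000000) + (1 - ?a) * (645385 / 10000000 - 6187 / 10000000)) / (693148 / 1000000)
      + ?a * (693147 / 1000000) / (645386 / 10000000) \<le> entropy_sum ?a"
    by (subst entropy_sum_near_sixteenth, simp, simp) (intro add_mono order_refl)
  moreover have "1 < 4 * ?a + (?a * (92791 / 10000000) + (1 - ?a) * (645385 / 10000000 - 6187 / 10000000)) / (693148 / 1000000)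
      + ?a * (693147 / 1000000) / (645386 / 10000000)" by simp
  ultimately show ?thesis by (rule less_le_trans[rotated])
qed

lemma solves_entropy_equation_iff:
  "solves_entropy_equation x \<longleftrightarrow> 0 < x \<and> x < 1 / 2 \<and> entropy_sum x = 1"
  by (simp add: solves_entropy_equation_def entropy_sum_def)

lemma solves_entropy_equation_bounds:
  assumes "solves_entropy_equation x"
  shows "6191 / 100000 < x \<and> x < 6192 / 100000"
proof -
  have x: "0 < x" "x < 1 / 2" "entropy_sum x = 1" using assms by (auto simp: solves_entropy_equation_iff)
  have "\<not> x \<le> 6191 / 100000"
    using entropy_sum_strict_mono[of x "6191 / 100000"] entropy_sum_lower_end x by (cases "x = 6191 / 100000") auto
  moreover have "\<not> x \<ge> 6192 / 100000"
    using entropy_sum_strict_mono[of "6192 / 100000" x] entropy_sum_upper_end x by (cases "x = 6192 / 100000") auto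
  ultimately show ?thesis by simp
qed

lemma solves_entropy_equation_ex1: "\<exists>!x. solves_entropy_equation x"
proof -
  have "\<exists>x. 6191 / 100000 \<le> x \<and> x \<le> 6192 / 100000 \<and> entropy_sum x = 1"
  proof (rule IVT')
    have "isCont entropy_sum x" if "6191 / 100000 \<le> x" "x \<le> 6192 / 100000" for x
      using that by (intro DERIV_isCont[OF entropy_sum_deriv]) auto
    then show "continuous_on {6191 / 100000..6192 / 100000} entropy_sum"
      by (intro continuous_at_imp_continuous_on) auto
  qed (use entropy_sum_lower_end entropy_sum_upper_end in auto)
  then obtain x where "6191 / 100000 \<le> x" "x \<le> 6192 / 100000" "entropy_sum x = 1" by blast
  then have "solves_entropy_equation x" by (simp add: solves_entropy_equation_iff)
  moreover have "y = z" if "solves_entropy_equation y" "solves_entropy_equation z" for y z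
    using that entropy_sum_strict_mono[of y z] entropy_sum_strict_mono[of z y]
    by (cases y z rule: linorder_cases) (auto simp: solves_entropy_equation_iff)
  ultimately show ?thesis by blast
qed

section \<open>Concentration of random signs modulo a prime\<close>

text \<open>Orthogonality of characters in real form: the sum is the real part of a geometric series
  in a \<open>p\<close>-th root of unity, which vanishes unless that root is 1.\<close>

lemma sum_cos_multiples:
  fixes k :: int
  assumes "p > 0"
  shows "(\<Sum>\<theta><p. cos (2 * pi * real \<theta> * of_int k / real p)) = (if int p dvd k then real p else 0)"
proof (cases "int p dvd k")
  case True
  then obtain l where l: "k = int p * l" by blast
  have "cos (2 * pi * real \<theta> * of_int k / real p) = 1" for \<theta>
  proof -
    have "2 * pi * real \<theta> * of_int k / real p = 2 * pi * of_int (int \<theta> * l)"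
      using assms by (simp add: l field_simps)
    then show ?thesis
      using cos_int_2pin[of "int \<theta> * l"] by (metis mult.commute mult.assoc)
  qed
  then show ?thesis using True by simp
next
  case False
  define z where "z = cis (2 * pi * of_int k / real p)"
  have zp: "z ^ p = 1"
    using assms cis_multiple_2pi[of "of_int k"] by (simp add: z_def Complex.DeMoivre)
  have "z \<noteq> 1"
  proof
    assume "z = 1"
    then have "cos (2 * pi * of_int k / real p) = 1"
      by (simp add: z_def complex_eq_iff)
    then obtain m :: int where m: "2 * pi * of_int k / real p = of_int m * 2 * pi"
      using cos_one_2pi_int by blast
    then have "real_of_int k = of_int m * real p"
      using assms by (simp add: field_simps)
    then have "k = m * int p"
      by (metis of_int_eq_iff of_int_mult of_int_of_nat_eq)
    then show False using False by simp
  qed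
  then have "(\<Sum>\<theta><p. z ^ \<theta>) = 0"
    using zp by (simp add: geometric_sum)
  then have "Re (\<Sum>\<theta><p. z ^ \<theta>) = 0" by simp
  moreover have "Re (z ^ \<theta>) = cos (2 * pi * real \<theta> * of_int k / real p)" for \<theta>
    by (simp add: z_def Complex.DeMoivre mult_ac)
  ultimately show ?thesis using False by simp
qed

section \<open>Signed sums, their Fourier expansion and the lazy walk\<close>

definition dot :: "int list \<Rightarrow> int list \<Rightarrow> int" where
  "dot xs ys = sum_list (map2 (*) xs ys)"

lemma dot_Nil [simp]: "dot [] ys = 0" "dot xs [] = 0"
  by (simp_all add: dot_def)

lemma dot_Cons [simp]: "dot (x # xs) (y # ys) = x * y + dot xs ys"
  by (simp add: dot_def)

definition signs :: "nat \<Rightarrow> int list set" where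
  "signs n = {xs. length xs = n \<and> set xs \<subseteq> {-1, 1}}"

lemma finite_signs [simp]: "finite (signs n)"
  and card_signs [simp]: "card (signs n) = 2 ^ n"
proof -
  have "signs n = {xs. set xs \<subseteq> {-1, 1} \<and> length xs = n}"
    by (auto simp: signs_def)
  then show "finite (signs n)" "card (signs n) = 2 ^ n"
    by (simp_all add: finite_lists_length_eq card_lists_length_eq flip: numeral_2_eq_2)
qed

lemma signs_0 [simp]: "signs 0 = {[]}"
  by (auto simp: signs_def)

lemma signs_Suc: "signs (Suc n) = (#) 1 ` signs n \<union> (#) (-1) ` signs n"
  by (auto simp: signs_def length_Suc_conv image_iff)

lemma sum_signs_Suc:
  fixes f :: "int list \<Rightarrow> 'b::comm_monoid_add"
  shows "sum f (signs (Suc n)) = (\<Sum>xs\<in>signs n. f (1 # xs)) + (\<Sum>xs\<in>signs n. f (-1 # xs))"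
  unfolding signs_Suc by (subst sum.union_disjoint) (auto simp: sum.reindex)

text \<open>For \<open>p = 0\<close> this is the probability that the signed sum vanishes.\<close>

definition sign_prob :: "int \<Rightarrow> int list \<Rightarrow> real" where
  "sign_prob p ws = card {xs \<in> signs (length ws). p dvd dot xs ws} / 2 ^ length ws"

lemma sign_prob_nonneg: "sign_prob p ws \<ge> 0"
  by (simp add: sign_prob_def)

text \<open>The free phase \<open>b\<close> carries the induction: fixing one sign shifts it by
  \<open>a * of_int w\<close> up or down, and the two shifted cosines recombine by the addition
  formula.\<close>

lemma sum_signs_cos:
  "(\<Sum>xs\<in>signs (length ws). cos (a * of_int (dot xs ws) + b :: real)) = 2 ^ length ws * (\<Prod>w\<leftarrow>ws. cos (a * of_int w)) * cos b"
proof (induction ws arbitrary: b)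
  case Nil
  then show ?case by simp
next
  case (Cons w ws)
  have "(\<Sum>xs\<in>signs (length (w # ws)). cos (a * of_int (dot xs (w # ws)) + b))
     = (\<Sum>xs\<in>signs (length ws). cos (a * of_int (dot xs ws) + (b + a * of_int w))) +
       (\<Sum>xs\<in>signs (length ws). cos (a * of_int (dot xs ws) + (b - a * of_int w)))"
    by (simp add: sum_signs_Suc algebra_simps)
  also have "\<dots> = 2 ^ length ws * (\<Prod>w\<leftarrow>ws. cos (a * of_int w)) * (cos (b + a * of_int w) + cos (b - a * of_int w))"
    by (simp only: Cons.IH distrib_left)
  also have "cos (b + a * of_int w) + cos (b - a * of_int w) = 2 * cos (a * of_int w) * cos b"
    by (simp add: cos_add cos_diff)
  finally show ?case by (simp add: algebra_simps)
qed

lemma sign_prob_eq_fourier: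
  assumes "p > 0"
  shows "sign_prob (int p) ws = (\<Sum>\<theta><p. \<Prod>w\<leftarrow>ws. cos (2 * pi * real \<theta> / real p * of_int w)) / real p"
proof -
  have "real (card {xs \<in> signs (length ws). int p dvd dot xs ws}) * p =
      (\<Sum>xs\<in>signs (length ws). if int p dvd dot xs ws then real p else 0)"
    by (simp add: sum.If_cases Int_def)
  also have "\<dots> = (\<Sum>xs\<in>signs (length ws). \<Sum>\<theta><p. cos (2 * pi * real \<theta> * of_int (dot xs ws) / real p))"
    using assms by (simp add: sum_cos_multiples)
  also have "\<dots> = (\<Sum>\<theta><p. \<Sum>xs\<in>signs (length ws). cos (2 * pi * real \<theta> / real p * of_int (dot xs ws) + 0))"
    by (subst sum.swap) simp
  also have "\<dots> = 2 ^ length ws * (\<Sum>\<theta><p. \<Prod>w\<leftarrow>ws. cos (2 * pi * real \<theta> / real p * of_int w))"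
    by (subst sum_signs_cos) (simp add: sum_distrib_left)
  finally show ?thesis using assms by (simp add: sign_prob_def field_simps)
qed

text \<open>The law modulo \<open>p\<close> of \<open>\<Sum>\<xi>\<^sub>i w\<^sub>i\<close>, where \<open>\<xi>\<^sub>i\<close> is \<open>0\<close> with
  probability \<open>3/4\<close> and \<open>\<plusminus>1\<close> with probability \<open>1/8\<close> each. It is defined through its Fourier
  coefficients, which are doubled in frequency; this is harmless for odd \<open>p\<close>.\<close>

definition lazy_weight :: "nat \<Rightarrow> int list \<Rightarrow> nat \<Rightarrow> real" where
  "lazy_weight p ws \<theta> = (\<Prod>w\<leftarrow>ws. 3 / 4 + cos (4 * pi * real \<theta> / real p * of_int w) / 4)"

definition lazy_prob :: "nat \<Rightarrow> int list \<Rightarrow> int \<Rightarrow> real" where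
  "lazy_prob p ws x = (\<Sum>\<theta><p. lazy_weight p ws \<theta> * cos (4 * pi * real \<theta> / real p * of_int x)) / real p"

lemma lazy_weight_nonneg: "lazy_weight p ws \<theta> \<ge> 0"
proof -
  have "3 / 4 + cos x / 4 \<ge> 0" for x :: real
    using cos_ge_minus_one[of x] by linarith
  then show ?thesis
    unfolding lazy_weight_def by (intro prod_list_nonneg) auto
qed

text \<open>This is \<open>2 * c \<le> 1 + c\<^sup>2\<close> for the absolute value \<open>c\<close>
  of the cosine. The right-hand side is the Fourier coefficient of a single lazy step, which is
  never negative.\<close>

lemma abs_cos_le: "\<bar>cos x\<bar> \<le> 3 / 4 + cos (2 * x) / 4" for x :: real
proof -
  have "0 \<le> (1 - \<bar>cos x\<bar>)\<^sup>2" by simp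
  then show ?thesis
    unfolding cos_double_cos by (simp add: power2_eq_square field_simps)
qed

lemma sign_prob_le_lazy_prob:
  assumes "p > 0"
  shows "sign_prob (int p) ws \<le> lazy_prob p ws 0"
proof -
  have "(\<Prod>w\<leftarrow>ws. cos (2 * pi * real \<theta> / real p * of_int w)) \<le> lazy_weight p ws \<theta>" for \<theta>
  proof -
    have "\<bar>\<Prod>w\<leftarrow>ws. cos (2 * pi * real \<theta> / real p * of_int w)\<bar> \<le> lazy_weight p ws \<theta>"
    proof (induction ws)
      case (Cons w ws)
      have "4 * pi * real \<theta> / real p * of_int w = 2 * (2 * pi * real \<theta> / real p * of_int w)" by simp
      then have "\<bar>cos (2 * pi * real \<theta> / real p * of_int w)\<bar> \<le> 3 / 4 + cos (4 * pi * real \<theta> / real p * of_int w) / 4"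
        using abs_cos_le by metis
      with Cons show ?case
        by (auto simp: lazy_weight_def abs_mult intro!: mult_mono)
    qed (simp add: lazy_weight_def)
    then show ?thesis by linarith
  qed
  then show ?thesis
    using assms by (simp add: sign_prob_eq_fourier lazy_prob_def divide_right_mono sum_mono)
qed

lemma lazy_prob_Nil:
  assumes "p > 0" "odd p"
  shows "lazy_prob p [] x = (if int p dvd x then 1 else 0)"
proof -
  have "lazy_prob p [] x = (\<Sum>\<theta><p. cos (2 * pi * real \<theta> * of_int (2 * x) / real p)) / real p"
    by (simp add: lazy_prob_def lazy_weight_def field_simps)
  also have "\<dots> = (if int p dvd 2 * x then 1 else 0)"
    using assms(1) by (subst sum_cos_multiples) auto
  also have "int p dvd 2 * x \<longleftrightarrow> int p dvd x"
    using assms(2) by (intro coprime_dvd_mult_right_iff) (simp add: coprime_commute)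
  finally show ?thesis .
qed

text \<open>Product-to-sum, frequency by frequency. The right-hand side is a convex combination, so
  nonnegativity, which the Fourier definition hides, follows by induction on the list.\<close>

lemma lazy_prob_Cons:
  "lazy_prob p (w # ws) x = 3 / 4 * lazy_prob p ws x + lazy_prob p ws (x + w) / 8 + lazy_prob p ws (x - w) / 8"
proof -
  have *: "lazy_weight p (w # ws) \<theta> * cos (4 * pi * real \<theta> / real p * of_int x) =
     3 / 4 * (lazy_weight p ws \<theta> * cos (4 * pi * real \<theta> / real p * of_int x)) +
     (lazy_weight p ws \<theta> * cos (4 * pi * real \<theta> / real p * of_int (x + w))) / 8 +
     (lazy_weight p ws \<theta> * cos (4 * pi * real \<theta> / real p * of_int (x - w))) / 8" for \<theta>
  proof -
    define c where "c = 4 * pi * real \<theta> / real p"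
    have "lazy_weight p (w # ws) \<theta> = (3 / 4 + cos (c * of_int w) / 4) * lazy_weight p ws \<theta>"
      by (simp add: lazy_weight_def c_def)
    moreover have "cos (c * of_int (x + w)) + cos (c * of_int (x - w)) = 2 * cos (c * of_int x) * cos (c * of_int w)"
      by (simp add: algebra_simps cos_add cos_diff)
    moreover have "(3 / 4 + C / 4) * L * X = 3 / 4 * (L * X) + L * P / 8 + L * Q / 8"
      if "P + Q = 2 * X * C" for C L X P Q :: real
    proof -
      have "L * P / 8 + L * Q / 8 = L * (P + Q) / 8" by (simp add: algebra_simps add_divide_distrib)
      then show ?thesis unfolding that by (simp add: algebra_simps)
    qed
    ultimately show ?thesis unfolding c_def[symmetric] by metis
  qed
  show ?thesis
    unfolding lazy_prob_def * sum.distrib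
    by (simp add: sum_distrib_left sum_divide_distrib add_divide_distrib mult.commute)
qed

lemma lazy_prob_nonneg:
  assumes "p > 0" "odd p"
  shows "lazy_prob p ws x \<ge> 0"
  using assms by (induction ws arbitrary: x) (auto simp: lazy_prob_Nil lazy_prob_Cons)

lemma lazy_prob_uminus: "lazy_prob p ws (- x) = lazy_prob p ws x"
  by (simp add: lazy_prob_def)

lemma lazy_prob_mod:
  assumes "p > 0"
  shows "lazy_prob p ws (x mod int p) = lazy_prob p ws x"
proof -
  have "cos (4 * pi * real \<theta> / real p * of_int (x mod int p)) = cos (4 * pi * real \<theta> / real p * of_int x)" for \<theta>
  proof -
    have "x = int p * (x div int p) + x mod int p" by simp
    then have "real_of_int x = real p * of_int (x div int p) + of_int (x mod int p)"
      by (metis of_int_add of_int_mult of_int_of_nat_eq)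
    then have "4 * pi * real \<theta> / real p * of_int x =
        4 * pi * real \<theta> / real p * of_int (x mod int p) + 2 * pi * of_int (2 * int \<theta> * (x div int p))"
      using assms by (simp add: field_simps)
    then show ?thesis
      by (simp add: cos_add cos_int_2pin sin_int_2pin del: of_int_mult of_int_add)
  qed
  then show ?thesis by (simp add: lazy_prob_def)
qed

text \<open>Summing over all residues kills every frequency except 0, because an odd
  \<open>p\<close> divides \<open>2 * \<theta>\<close> only for \<open>\<theta> = 0\<close>; the
  weight at 0 is 1.\<close>

lemma sum_lazy_prob:
  assumes "p > 0" "odd p"
  shows "(\<Sum>x\<in>{0..<int p}. lazy_prob p ws x) = 1"
proof -
  have "(\<Sum>x\<in>{0..<int p}. lazy_prob p ws x) = (\<Sum>x<p. lazy_prob p ws (int x))"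
    by (rule sum.reindex_bij_witness[of _ int nat]) auto
  also have "\<dots> = (\<Sum>\<theta><p. lazy_weight p ws \<theta> * (\<Sum>x<p. cos (2 * pi * real x * of_int (2 * int \<theta>) / real p))) / real p"
    unfolding lazy_prob_def
    by (simp add: sum_divide_distrib[symmetric] sum_distrib_left, subst sum.swap, simp add: mult_ac)
  also have "\<dots> = (\<Sum>\<theta><p. lazy_weight p ws \<theta> * (if \<theta> = 0 then real p else 0)) / real p"
  proof -
    have "int p dvd 2 * int \<theta> \<longleftrightarrow> \<theta> = 0" if "\<theta> < p" for \<theta>
    proof -
      have "int p dvd 2 * int \<theta> \<longleftrightarrow> int p dvd int \<theta>"
        using assms(2) by (intro coprime_dvd_mult_right_iff) (simp add: coprime_commute)
      then show ?thesis using that by (auto dest: dvd_imp_le)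
    qed
    then show ?thesis using assms(1)
      by (intro arg_cong[where f = "\<lambda>x. x / real p"] sum.cong refl) (subst sum_cos_multiples, auto)
  qed
  also have "\<dots> = lazy_weight p ws 0"
    using assms(1) by (simp add: if_distrib cong: if_cong)
  also have "\<dots> = 1"
    by (induction ws) (auto simp: lazy_weight_def)
  finally show ?thesis .
qed

text \<open>Since \<open>lazy_prob\<close> is even, prepending a coordinate \<open>w\<close> lowers
  the return probability by exactly a quarter of this gap.\<close>

definition lazy_gap :: "nat \<Rightarrow> int list \<Rightarrow> int \<Rightarrow> real" where
  "lazy_gap p ws x = lazy_prob p ws 0 - lazy_prob p ws x"

text \<open>Nonnegative weights and \<open>1 - cos (2 * y) = 2 * (sin y)\<^sup>2\<close> exhibit the
  gap as a squared Euclidean norm, so that its square root can be treated like a norm in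
  \<open>x\<close>.\<close>

lemma lazy_gap_eq:
  "lazy_gap p ws x = (\<Sum>\<theta><p. (sqrt (2 * lazy_weight p ws \<theta> / real p) * sin (2 * pi * real \<theta> / real p * of_int x))\<^sup>2)"
proof -
  have "(sqrt (2 * lazy_weight p ws \<theta> / real p) * sin (2 * pi * real \<theta> / real p * of_int x))\<^sup>2 =
     lazy_weight p ws \<theta> * (1 - cos (4 * pi * real \<theta> / real p * of_int x)) / real p" for \<theta>
  proof -
    have "4 * pi * real \<theta> / real p * of_int x = 2 * (2 * pi * real \<theta> / real p * of_int x)" by simp
    then have "1 - cos (4 * pi * real \<theta> / real p * of_int x) = 2 * (sin (2 * pi * real \<theta> / real p * of_int x))\<^sup>2"
      by (simp only: cos_double_sin)
    moreover have "(sqrt (2 * lazy_weight p ws \<theta> / real p))\<^sup>2 = 2 * lazy_weight p ws \<theta> / real p"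
      using lazy_weight_nonneg by simp
    ultimately show ?thesis by (simp add: power_mult_distrib)
  qed
  then show ?thesis
    by (simp add: lazy_gap_def lazy_prob_def right_diff_distrib diff_divide_distrib sum_subtractf sum_divide_distrib)
qed

lemma lazy_gap_nonneg: "lazy_gap p ws x \<ge> 0"
  by (simp add: lazy_gap_eq sum_nonneg)

text \<open>The absolute value of the sine is subadditive; Minkowski's inequality transfers this to
  the norm. Hence a sum of \<open>j\<close> residues of small gap has a gap larger by a factor of at
  most \<open>j\<^sup>2\<close>.\<close>

lemma sqrt_lazy_gap_add: "sqrt (lazy_gap p ws (x + y)) \<le> sqrt (lazy_gap p ws x) + sqrt (lazy_gap p ws y)"
proof -
  define c where "c \<theta> = sqrt (2 * lazy_weight p ws \<theta> / real p)" for \<theta>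
  define s where "s x \<theta> = \<bar>sin (2 * pi * real \<theta> / real p * of_int x)\<bar>" for x :: int and \<theta> :: nat
  have eq: "sqrt (lazy_gap p ws x) = L2_set (\<lambda>\<theta>. c \<theta> * s x \<theta>) {..<p}" for x
    by (simp add: lazy_gap_eq L2_set_def c_def s_def power_mult_distrib)
  have s: "s (x + y) \<theta> \<le> s x \<theta> + s y \<theta>" for \<theta>
  proof -
    have "\<bar>sin (a + b)\<bar> \<le> \<bar>sin a\<bar> + \<bar>sin b\<bar>" for a b :: real
    proof -
      have "\<bar>sin (a + b)\<bar> \<le> \<bar>sin a\<bar> * \<bar>cos b\<bar> + \<bar>cos a\<bar> * \<bar>sin b\<bar>"
        unfolding sin_add abs_mult[symmetric] by (rule abs_triangle_ineq)
      also have "\<dots> \<le> \<bar>sin a\<bar> * 1 + 1 * \<bar>sin b\<bar>"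
        by (intro add_mono mult_mono) auto
      finally show ?thesis by simp
    qed
    then show ?thesis by (simp add: s_def distrib_left)
  qed
  have "L2_set (\<lambda>\<theta>. c \<theta> * s (x + y) \<theta>) {..<p} \<le> L2_set (\<lambda>\<theta>. c \<theta> * s x \<theta> + c \<theta> * s y \<theta>) {..<p}"
  proof (rule L2_set_mono)
    fix \<theta>
    have c: "c \<theta> \<ge> 0" by (simp add: c_def lazy_weight_nonneg)
    then show "c \<theta> * s (x + y) \<theta> \<le> c \<theta> * s x \<theta> + c \<theta> * s y \<theta>"
      using mult_left_mono[OF s c] by (simp add: distrib_left)
    show "0 \<le> c \<theta> * s (x + y) \<theta>" using c by (simp add: s_def)
  qed
  also have "\<dots> \<le> L2_set (\<lambda>\<theta>. c \<theta> * s x \<theta>) {..<p} + L2_set (\<lambda>\<theta>. c \<theta> * s y \<theta>) {..<p}"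
    by (rule L2_set_triangle_ineq)
  finally show ?thesis by (simp add: eq)
qed

lemma lazy_prob_Cons_0: "lazy_prob p (w # ws) 0 = lazy_prob p ws 0 - lazy_gap p ws w / 4"
  by (simp add: lazy_prob_Cons lazy_prob_uminus lazy_gap_def field_simps)

section \<open>Growth of sublevel sets\<close>

text \<open>A nonzero \<open>a\<close> is invertible modulo \<open>p\<close>, so every residue is a
  multiple of \<open>a\<close> and is reached from 0.\<close>

lemma closed_add_prime_residues:
  fixes S :: "int set"
  assumes p: "prime p" and a: "a \<in> {0<..<p}" and S0: "0 \<in> S"
    and closed: "\<And>x. x \<in> S \<Longrightarrow> (x + a) mod p \<in> S"
  shows "{0..<p} \<subseteq> S"
proof
  fix y assume y: "y \<in> {0..<p}"
  have mult: "(int k * a) mod p \<in> S" for k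
  proof (induction k)
    case (Suc k)
    have "(int (Suc k) * a) mod p = ((int k * a) mod p + a) mod p"
      by (simp add: mod_simps algebra_simps)
    then show ?case using closed[OF Suc] by simp
  qed (use S0 in simp)
  have "coprime a p"
    using p a by (metis coprime_commute greaterThanLessThan_iff prime_imp_coprime zdvd_not_zless)
  then obtain b where b: "[a * b = 1] (mod p)"
    using cong_solve_coprime_int by blast
  define k where "k = nat ((b * y) mod p)"
  have "int k = (b * y) mod p"
    using p by (simp add: k_def prime_gt_0_int)
  then have "(int k * a) mod p = (a * b * y) mod p"
    by (simp add: mod_simps algebra_simps)
  also have "\<dots> = y mod p"
    using b by (metis cong_def cong_scalar_right mult_1)
  also have "\<dots> = y" using y by simp
  finally show "y \<in> S" using mult by metis
qed

text \<open>The \<open>j\<close>-fold sums of \<open>A = {g \<le> \<eta>r}\<close> keep growing, since a set of residues closed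
  under adding a nonzero element is everything; picking a new element at every third stage gives
  disjoint translates of \<open>A\<close>, all inside \<open>{g \<le> r/2}\<close>.\<close>
lemma card_sublevel_growth:
  fixes g :: "int \<Rightarrow> real" and p :: int
  assumes p: "prime p"
    and g0: "g 0 = 0" and gpos: "\<And>x. g x \<ge> 0" and gm: "\<And>x. g (- x) = g x"
    and gmod: "\<And>x. g (x mod p) = g x"
    and gadd: "\<And>x y. sqrt (g (x + y)) \<le> sqrt (g x) + sqrt (g y)"
    and r: "r > 0" and \<eta>: "\<eta> \<ge> 0" "real (3 * m + 1) ^ 2 * \<eta> \<le> 1 / 2"
    and half: "card {x \<in> {0..<p}. g x \<le> r / 2} < nat p"
  defines "A \<equiv> {x \<in> {0..<p}. g x \<le> \<eta> * r}"
  shows "card A = 1 \<or> (m + 1) * card A \<le> card {x \<in> {0..<p}. g x \<le> r / 2}"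
proof -
  have p0: "p > 0" using p by (simp add: prime_gt_0_int)
  define s where "s = sqrt (\<eta> * r)"
  have s0: "s \<ge> 0" using \<eta> r by (simp add: s_def)
  have A_iff: "x \<in> A \<longleftrightarrow> x \<in> {0..<p} \<and> sqrt (g x) \<le> s" for x
    by (auto simp: A_def s_def)
  have A0: "0 \<in> A" using p0 \<eta> r g0 by (simp add: A_def)
  have finA: "finite A" by (rule finite_subset[of _ "{0..<p}"]) (auto simp: A_def)
  define B where "B = {x \<in> {0..<p}. g x \<le> r / 2}"
  have finB: "finite B" by (rule finite_subset[of _ "{0..<p}"]) (auto simp: B_def)
  \<comment> \<open>\<open>S j\<close> consists of the residues of sums of \<open>j\<close> elements
    of \<open>A\<close>. It increases with \<open>j\<close> because \<open>A\<close> contains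
    0.\<close>
  define S where "S j = (((\<lambda>X. (\<lambda>(x, a). (x + a) mod p) ` (X \<times> A)) ^^ j) {0})" for j
  have S_0: "S 0 = {0}" by (simp add: S_def)
  have S_Suc: "S (Suc j) = (\<lambda>(x, a). (x + a) mod p) ` (S j \<times> A)" for j
    by (simp add: S_def)
  have S_sub: "S j \<subseteq> {0..<p}" for j
    by (cases j) (use p0 in \<open>auto simp: S_0 S_Suc\<close>)
  have S_step: "S j \<subseteq> S (Suc j)" for j
  proof
    fix x assume x: "x \<in> S j"
    then have "x = (x + 0) mod p" using S_sub[of j] by auto
    then show "x \<in> S (Suc j)" unfolding S_Suc using x A0 by force
  qed
  have S_mono: "i \<le> j \<Longrightarrow> S i \<subseteq> S j" for i j
    using S_step by (rule lift_Suc_mono_le)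
  have S_g: "x \<in> S j \<Longrightarrow> sqrt (g x) \<le> real j * s" for x j
  proof (induction j arbitrary: x)
    case 0
    then show ?case by (simp add: S_0 g0)
  next
    case (Suc j)
    then obtain y a where ya: "x = (y + a) mod p" "y \<in> S j" "a \<in> A" by (auto simp: S_Suc)
    have "sqrt (g x) \<le> sqrt (g y) + sqrt (g a)" using gadd ya(1) gmod by metis
    also have "\<dots> \<le> real j * s + s" using Suc.IH ya A_iff by (intro add_mono) auto
    finally show ?case by (simp add: algebra_simps)
  qed
  \<comment> \<open>The hypothesis on \<open>\<eta>\<close> is exactly what keeps the sums inside
    the half level up to stage \<open>3 * m + 1\<close>.\<close>
  have js: "real j * s \<le> sqrt (r / 2)" if "j \<le> 3 * m + 1" for j
  proof -
    have "real j ^ 2 * (\<eta> * r) \<le> real (3 * m + 1) ^ 2 * (\<eta> * r)"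
      using that \<eta> r by (intro mult_right_mono power_mono) auto
    also have "\<dots> \<le> 1 / 2 * r" using \<eta>(2) r by (simp only: mult.assoc[symmetric] mult_right_mono less_imp_le)
    finally have "sqrt (real j ^ 2 * (\<eta> * r)) \<le> sqrt (r / 2)" by simp
    then show ?thesis by (simp add: real_sqrt_mult s_def)
  qed
  have S_B: "S j \<subseteq> B" if "j \<le> 3 * m + 1" for j
  proof
    fix x assume x: "x \<in> S j"
    then have "sqrt (g x) \<le> sqrt (r / 2)" using S_g[OF x] js[OF that] by linarith
    then show "x \<in> B" using S_sub[of j] x by (auto simp: B_def)
  qed
  show ?thesis
  proof (cases "\<exists>a\<in>A. a \<noteq> 0")
    case False
    then have "A = {0}" using A0 by auto
    then show ?thesis by simp
  next
    case True
    then obtain a where a: "a \<in> A" "a \<noteq> 0" by blast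
    have a': "a \<in> {0<..<p}" using a by (auto simp: A_def)
    have strict: "S j \<noteq> S (Suc j)" if "j \<le> 3 * m" for j
    proof
      assume eq: "S j = S (Suc j)"
      have "{0..<p} \<subseteq> S j"
      proof (rule closed_add_prime_residues[OF p a'])
        show "0 \<in> S j" using S_mono[of 0 j] S_0 by auto
        show "(x + a) mod p \<in> S j" if "x \<in> S j" for x
        proof -
          have "(x + a) mod p \<in> S (Suc j)" unfolding S_Suc using that a by force
          then show ?thesis using eq by simp
        qed
      qed
      also have "S j \<subseteq> B" using S_B that by simp
      finally have "card {0..<p} \<le> card B"
        by (intro card_mono finB)
      then show False using half by (simp add: B_def)
    qed
    \<comment> \<open>An element that is new at stage \<open>j\<close>. Stage 0 is separate because
      truncated subtraction would make \<open>S (0 - 1)\<close> equal to \<open>S 0\<close>.\<close>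
    define y where "y j = (SOME x. x \<in> S j - (if j = 0 then {} else S (j - 1)))" for j
    have y: "y j \<in> S j - (if j = 0 then {} else S (j - 1))" if "j \<le> 3 * m" for j
    proof -
      have "\<exists>x. x \<in> S j - (if j = 0 then {} else S (j - 1))"
      proof (cases j)
        case 0
        then show ?thesis by (simp add: S_0)
      next
        case (Suc i)
        then show ?thesis using strict[of i] S_step[of i] that by auto
      qed
      then show ?thesis unfolding y_def by (rule someI_ex)
    qed
    define T where "T i = (\<lambda>a. (y (3 * i) + a) mod p) ` A" for i
    have T_sub: "T i \<subseteq> B" if "i \<le> m" for i
    proof -
      have "T i \<subseteq> S (Suc (3 * i))"
        using y[of "3 * i"] that by (force simp: T_def S_Suc)
      then show ?thesis using S_B[of "Suc (3 * i)"] that by auto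
    qed
    have T_card: "card (T i) = card A" if "i \<le> m" for i
      unfolding T_def
    proof (rule card_image, rule inj_onI)
      fix u v assume uv: "u \<in> A" "v \<in> A" "(y (3 * i) + u) mod p = (y (3 * i) + v) mod p"
      then have "(y (3 * i) + u - y (3 * i)) mod p = (y (3 * i) + v - y (3 * i)) mod p"
        by (metis mod_diff_left_eq)
      then show "u = v" using uv by (simp add: A_def)
    qed
    \<comment> \<open>A common point would give \<open>y (3 * i) = y (3 * j) + v - u\<close> modulo
      \<open>p\<close>. As \<open>A\<close> is symmetric, this lies in \<open>S (3 * j + 2)\<close>,
      hence in \<open>S (3 * i - 1)\<close>, and is not new at stage \<open>3 * i\<close>. This is
      why the stages are three apart.\<close>
    have T_disj: "T i \<inter> T j = {}" if "i \<le> m" "j < i" for i j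
    proof (rule ccontr)
      assume "T i \<inter> T j \<noteq> {}"
      then obtain u v where uv: "u \<in> A" "v \<in> A" "(y (3 * i) + u) mod p = (y (3 * j) + v) mod p"
        by (auto simp: T_def)
      have yi: "y (3 * i) \<in> S (3 * i)" "y (3 * i) \<notin> S (3 * i - 1)"
        using y[of "3 * i"] that by (auto split: if_splits)
      have yj: "y (3 * j) \<in> S (3 * j)" using y[of "3 * j"] that by auto
      have u': "(- u) mod p \<in> A"
        using uv(1) p0 by (auto simp: A_def gmod gm)
      have "y (3 * i) = y (3 * i) mod p" using yi(1) S_sub[of "3 * i"] by auto
      also have "\<dots> = ((y (3 * i) + u) mod p + (- u) mod p) mod p"
        by (simp add: mod_simps)
      also have "\<dots> = ((y (3 * j) + v) mod p + (- u) mod p) mod p"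
        using uv(3) by simp
      also have "\<dots> \<in> S (Suc (Suc (3 * j)))"
      proof -
        have "(y (3 * j) + v) mod p \<in> S (Suc (3 * j))" using yj uv(2) by (force simp: S_Suc)
        then show ?thesis using u' by (subst S_Suc) force
      qed
      also have "S (Suc (Suc (3 * j))) \<subseteq> S (3 * i - 1)" using that by (intro S_mono) auto
      finally show False using yi(2) by blast
    qed
    have "card (\<Union>i\<in>{..m}. T i) = (\<Sum>i\<in>{..m}. card (T i))"
    proof (rule card_UN_disjoint)
      show "\<forall>i\<in>{..m}. \<forall>j\<in>{..m}. i \<noteq> j \<longrightarrow> T i \<inter> T j = {}"
        using T_disj by (metis Int_commute atMost_iff linorder_neqE_nat)
    qed (auto simp: T_def finA)
    also have "\<dots> = (m + 1) * card A" using T_card by simp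
    finally have "(m + 1) * card A = card (\<Union>i\<in>{..m}. T i)" ..
    also have "\<dots> \<le> card B"
      using T_sub by (intro card_mono finB) auto
    finally show ?thesis by (simp add: B_def)
  qed
qed

section \<open>Counting concentrated residue vectors\<close>

text \<open>Vectors are built by prepending: the tail \<open>ws\<close> holds the coordinates chosen
  earlier, and \<open>G ws w\<close> judges the next choice \<open>w\<close> against them.\<close>

fun bad_count :: "('a list \<Rightarrow> 'a \<Rightarrow> bool) \<Rightarrow> 'a list \<Rightarrow> nat" where
  "bad_count G [] = 0"
| "bad_count G (w # ws) = (if G ws w then 0 else 1) + bad_count G ws"

lemma finite_bounded_lists:
  "finite A \<Longrightarrow> finite {ws. length ws = n \<and> set ws \<subseteq> A \<and> P ws}"
  by (rule finite_subset[OF _ finite_lists_length_eq[of A n]]) auto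

text \<open>A good coordinate has at most \<open>b\<close> choices, a bad one at most
  \<open>p\<close>, and at most \<open>e\<close> are bad. Charging \<open>1 / \<kappa>\<close> for
  each bad step replaces the binomial count of their positions: the induction closes because
  \<open>b + \<kappa> * b = (1 + \<kappa>) * b\<close>.\<close>

lemma card_few_bad:
  fixes A :: "'a set" and b \<kappa> :: real
  assumes A: "finite A" "card A = p" "p > 0" and \<kappa>: "0 < \<kappa>" "\<kappa> \<le> 1"
    and tail: "\<And>w ws. alive (w # ws) \<Longrightarrow> alive ws"
    and b: "b \<ge> 0" "\<And>ws. set ws \<subseteq> A \<Longrightarrow> alive ws \<Longrightarrow> real (card {w \<in> A. G ws w}) \<le> b"
  shows "real (card {ws. length ws = n \<and> set ws \<subseteq> A \<and> (alive ws \<and> bad_count G ws \<le> e)})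
       \<le> (1 + \<kappa>) ^ n * (real p / \<kappa>) ^ e * b ^ (n - e)"
proof (induction n arbitrary: e)
  case 0
  have "card {ws. length ws = 0 \<and> set ws \<subseteq> A \<and> (alive ws \<and> bad_count G ws \<le> e)} \<le> card {[] :: 'a list}"
    by (intro card_mono) auto
  moreover have "1 \<le> (real p / \<kappa>) ^ e"
    using A \<kappa> by (intro one_le_power) (simp add: field_simps)
  ultimately show ?case by simp
next
  case (Suc n)
  define L where "L n e = {ws. length ws = n \<and> set ws \<subseteq> A \<and> (alive ws \<and> bad_count G ws \<le> e)}" for n e
  have finL: "finite (L n e)" for n e
    unfolding L_def by (rule finite_bounded_lists) (rule A)
  note IH = Suc.IH[folded L_def]
  have good_part: "real (card ((\<lambda>(ws, w). w # ws) ` (SIGMA ws : L n e. {w \<in> A. G ws w}))) \<le>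
      b * ((1 + \<kappa>) ^ n * (real p / \<kappa>) ^ e * b ^ (n - e))"
  proof -
    have "card ((\<lambda>(ws, w). w # ws) ` (SIGMA ws : L n e. {w \<in> A. G ws w})) \<le> card (SIGMA ws : L n e. {w \<in> A. G ws w})"
      by (intro card_image_le finite_SigmaI finL) (simp add: A)
    also have "\<dots> = (\<Sum>ws\<in>L n e. card {w \<in> A. G ws w})"
      by (intro card_SigmaI finL) (simp add: A)
    finally have "real (card ((\<lambda>(ws, w). w # ws) ` (SIGMA ws : L n e. {w \<in> A. G ws w}))) \<le> (\<Sum>ws\<in>L n e. real (card {w \<in> A. G ws w}))"
      unfolding of_nat_sum[symmetric] of_nat_le_iff .
    also have "\<dots> \<le> (\<Sum>ws\<in>L n e. b)"
      using b(2) by (intro sum_mono) (auto simp: L_def)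
    also have "\<dots> = b * real (card (L n e))" by simp
    also have "\<dots> \<le> b * ((1 + \<kappa>) ^ n * (real p / \<kappa>) ^ e * b ^ (n - e))"
      using IH b(1) by (intro mult_left_mono) auto
    finally show ?thesis .
  qed
  show ?case
  proof (cases "e \<ge> Suc n")
    case True
    \<comment> \<open>No constraint remains when every coordinate may be bad: the trivial count
      suffices, and \<open>Suc n - e\<close> truncates to 0.\<close>
    have "card {ws. length ws = Suc n \<and> set ws \<subseteq> A \<and> (alive ws \<and> bad_count G ws \<le> e)} \<le> card {ws. set ws \<subseteq> A \<and> length ws = Suc n}"
      using A by (intro card_mono finite_lists_length_eq) auto
    also have "\<dots> = p ^ Suc n" using A by (simp add: card_lists_length_eq)
    finally have "real (card {ws. length ws = Suc n \<and> set ws \<subseteq> A \<and> (alive ws \<and> bad_count G ws \<le> e)}) \<le> real p ^ Suc n"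
      unfolding of_nat_power[symmetric] of_nat_le_iff .
    also have "\<dots> \<le> (real p / \<kappa>) ^ Suc n"
      using A \<kappa> by (intro power_mono) (auto simp: field_simps)
    also have "\<dots> \<le> (real p / \<kappa>) ^ e"
      using A \<kappa> True by (intro power_increasing) (auto simp: field_simps)
    also have "\<dots> \<le> (1 + \<kappa>) ^ Suc n * (real p / \<kappa>) ^ e"
      using mult_right_mono[of 1 "(1 + \<kappa>) ^ Suc n" "(real p / \<kappa>) ^ e"] \<kappa> one_le_power[of "1 + \<kappa>" "Suc n"] by simp
    finally show ?thesis using True by simp
  next
    case False
    have sub: "L (Suc n) e \<subseteq> (\<lambda>(ws, w). w # ws) ` (SIGMA ws : L n e. {w \<in> A. G ws w}) \<union>
       (if e = 0 then {} else (\<lambda>(ws, w). w # ws) ` (L n (e - 1) \<times> A))"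
    proof
      fix x assume x: "x \<in> L (Suc n) e"
      then obtain w ws where [simp]: "x = w # ws" by (auto simp: L_def length_Suc_conv)
      show "x \<in> (\<lambda>(ws, w). w # ws) ` (SIGMA ws : L n e. {w \<in> A. G ws w}) \<union>
         (if e = 0 then {} else (\<lambda>(ws, w). w # ws) ` (L n (e - 1) \<times> A))"
      proof (cases "G ws w")
        case True
        then have "(ws, w) \<in> (SIGMA ws : L n e. {w \<in> A. G ws w})"
          using x tail[of w ws] by (auto simp: L_def)
        then show ?thesis by (intro UnI1 image_eqI[of _ _ "(ws, w)"]) auto
      next
        case False
        then have "e \<noteq> 0" "(ws, w) \<in> L n (e - 1) \<times> A"
          using x tail[of w ws] by (auto simp: L_def)
        then show ?thesis by (intro UnI2) (auto intro: image_eqI[of _ _ "(ws, w)"])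
      qed
    qed
    have "real (card (L (Suc n) e)) \<le> real (card ((\<lambda>(ws, w). w # ws) ` (SIGMA ws : L n e. {w \<in> A. G ws w}))) +
       real (card (if e = 0 then {} else (\<lambda>(ws, w). w # ws) ` (L n (e - 1) \<times> A)))"
    proof -
      have "card (L (Suc n) e) \<le> card ((\<lambda>(ws, w). w # ws) ` (SIGMA ws : L n e. {w \<in> A. G ws w}) \<union>
         (if e = 0 then {} else (\<lambda>(ws, w). w # ws) ` (L n (e - 1) \<times> A)))"
        by (rule card_mono[OF _ sub])
          (simp add: finL A finite_SigmaI finite_cartesian_product)
      also have "\<dots> \<le> card ((\<lambda>(ws, w). w # ws) ` (SIGMA ws : L n e. {w \<in> A. G ws w})) +
         card (if e = 0 then {} else (\<lambda>(ws, w). w # ws) ` (L n (e - 1) \<times> A))"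
        by (rule card_Un_le)
      finally show ?thesis by linarith
    qed
    also have "real (card (if e = 0 then {} else (\<lambda>(ws, w). w # ws) ` (L n (e - 1) \<times> A))) \<le>
       \<kappa> * b * ((1 + \<kappa>) ^ n * (real p / \<kappa>) ^ e * b ^ (n - e))"
    proof (cases e)
      case 0
      then show ?thesis using \<kappa> b(1) by simp
    next
      case (Suc e')
      have "card ((\<lambda>(ws, w). w # ws) ` (L n e' \<times> A)) \<le> card (L n e' \<times> A)"
        by (intro card_image_le finite_cartesian_product finL A)
      also have "\<dots> = card (L n e') * p" using A by (simp add: card_cartesian_product)
      finally have "real (card ((\<lambda>(ws, w). w # ws) ` (L n e' \<times> A))) \<le> real (card (L n e')) * real p"
        unfolding of_nat_mult[symmetric] of_nat_le_iff .
      also have "\<dots> \<le> ((1 + \<kappa>) ^ n * (real p / \<kappa>) ^ e' * b ^ (n - e')) * real p"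
        by (intro mult_right_mono IH) auto
      \<comment> \<open>One bad step less in the allowance means one more factor \<open>b\<close>,
        so the bad branch costs only \<open>\<kappa> * b\<close> times the bound for length
        \<open>n\<close>.\<close>
      also have "n - e' = Suc (n - e)" using Suc False by simp
      also have "((1 + \<kappa>) ^ n * (real p / \<kappa>) ^ e' * b ^ Suc (n - e)) * real p =
         \<kappa> * b * ((1 + \<kappa>) ^ n * (real p / \<kappa>) ^ e * b ^ (n - e))"
        using \<kappa> Suc by (simp add: field_simps)
      finally show ?thesis using Suc by simp
    qed
    also note good_part
    also have "b * ((1 + \<kappa>) ^ n * (real p / \<kappa>) ^ e * b ^ (n - e)) + \<kappa> * b * ((1 + \<kappa>) ^ n * (real p / \<kappa>) ^ e * b ^ (n - e))
       = (1 + \<kappa>) ^ Suc n * (real p / \<kappa>) ^ e * b ^ Suc (n - e)"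
      by (simp add: algebra_simps)
    also have "Suc (n - e) = Suc n - e" using False by simp
    finally show ?thesis by (simp add: L_def)
  qed
qed

text \<open>A bad step multiplies \<open>lazy_prob p ws 0\<close> by at most \<open>61/80\<close> above the threshold \<open>\<Theta>\<close>
  and by at most \<open>1 - \<eta>/4\<close> below it.\<close>

definition good_step :: "nat \<Rightarrow> real \<Rightarrow> real \<Rightarrow> int list \<Rightarrow> int \<Rightarrow> bool" where
  "good_step p \<Theta> \<eta> ws w \<longleftrightarrow>
     lazy_gap p ws w \<le> (if lazy_prob p ws 0 \<ge> \<Theta> then 19 / 20 else \<eta>) * lazy_prob p ws 0"

lemma lazy_prob_Cons_le: "lazy_prob p (w # ws) 0 \<le> lazy_prob p ws 0"
  using lazy_gap_nonneg[of p ws w] by (simp add: lazy_prob_Cons_0)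

lemma lazy_prob_0_le_1:
  assumes "p > 0" "odd p"
  shows "lazy_prob p ws 0 \<le> 1"
proof (induction ws)
  case (Cons w ws)
  then show ?case using lazy_prob_Cons_le[of p w ws] by linarith
qed (use assms in \<open>simp add: lazy_prob_Nil\<close>)

text \<open>Here \<open>a\<close> counts the bad steps taken at values at least
  \<open>\<Theta>\<close> and \<open>c\<close> those below. Values never increase and never exceed
  1, so the first kind occurs only if \<open>\<Theta> \<le> 1\<close>, and the decay of the second
  kind starts from below \<open>\<Theta>\<close>.\<close>

lemma bad_count_bound:
  assumes p: "p > 0" "odd p" and \<eta>: "0 \<le> \<eta>" "\<eta> \<le> 1" and \<Theta>: "\<Theta> > 0"
  shows "\<exists>a c. bad_count (good_step p \<Theta> \<eta>) ws = a + c \<and> lazy_prob p ws 0 \<le> (61 / 80) ^ a \<and>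
           (a = 0 \<or> \<Theta> \<le> 1) \<and> (c = 0 \<or> lazy_prob p ws 0 \<le> \<Theta> * (1 - \<eta> / 4) ^ c)"
proof (induction ws)
  case Nil
  show ?case using p by (intro exI[of _ 0]) (simp add: lazy_prob_Nil)
next
  case (Cons w ws)
  then obtain a c where IH: "bad_count (good_step p \<Theta> \<eta>) ws = a + c" "lazy_prob p ws 0 \<le> (61 / 80) ^ a"
     "a = 0 \<or> \<Theta> \<le> 1" "c = 0 \<or> lazy_prob p ws 0 \<le> \<Theta> * (1 - \<eta> / 4) ^ c" by blast
  define r r' where "r = lazy_prob p ws 0" and "r' = lazy_prob p (w # ws) 0"
  have r: "r \<ge> 0" "r \<le> 1" "r' \<le> r" "r' = r - lazy_gap p ws w / 4"
    using lazy_prob_nonneg[OF p] lazy_prob_0_le_1[OF p] lazy_prob_Cons_le lazy_prob_Cons_0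
    by (auto simp: r_def r'_def)
  note IH = IH[folded r_def]
  have wit: ?case if "bad_count (good_step p \<Theta> \<eta>) (w # ws) = a' + c'" "r' \<le> (61 / 80) ^ a'"
     "a' = 0 \<or> \<Theta> \<le> 1" "c' = 0 \<or> r' \<le> \<Theta> * (1 - \<eta> / 4) ^ c'" for a' c'
    using that unfolding r'_def by blast
  show ?case
  proof (cases "good_step p \<Theta> \<eta> ws w")
    case True
    show ?thesis
      by (rule wit[of a c]) (use True IH r in \<open>auto intro: order_trans\<close>)
  next
    case bad: False
    show ?thesis
    proof (cases "r \<ge> \<Theta>")
      case True
      \<comment> \<open>The factor is \<open>1 - (19 / 20) / 4\<close>.\<close>
      then have "r' \<le> 61 / 80 * r" using bad r by (simp add: good_step_def flip: r_def)
      also have "\<dots> \<le> (61 / 80) ^ Suc a" using IH by simp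
      finally have *: "r' \<le> (61 / 80) ^ Suc a" .
      show ?thesis
        by (rule wit[of "Suc a" c]) (use * IH bad True r in \<open>auto intro: order_trans\<close>)
    next
      case False
      then have "r' \<le> (1 - \<eta> / 4) * r" using bad r by (simp add: good_step_def algebra_simps flip: r_def)
      also have "\<dots> \<le> (1 - \<eta> / 4) * (\<Theta> * (1 - \<eta> / 4) ^ c)"
        using IH False \<eta> by (intro mult_left_mono) auto
      finally have *: "r' \<le> \<Theta> * (1 - \<eta> / 4) ^ Suc c" by (simp add: mult_ac)
      show ?thesis
        by (rule wit[of a "Suc c"]) (use * IH bad r in \<open>auto intro: order_trans\<close>)
    qed
  qed
qed

text \<open>Markov's inequality for total mass 1.\<close>

lemma card_lazy_prob_ge:
  assumes p: "p > 0" "odd p" and t: "t > 0"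
  shows "real (card {x \<in> {0..<int p}. lazy_prob p ws x \<ge> t}) \<le> 1 / t"
proof -
  have "real (card {x \<in> {0..<int p}. lazy_prob p ws x \<ge> t}) * t = (\<Sum>x \<in> {x \<in> {0..<int p}. lazy_prob p ws x \<ge> t}. t)"
    by simp
  also have "\<dots> \<le> (\<Sum>x \<in> {x \<in> {0..<int p}. lazy_prob p ws x \<ge> t}. lazy_prob p ws x)"
    by (intro sum_mono) auto
  also have "\<dots> \<le> (\<Sum>x \<in> {0..<int p}. lazy_prob p ws x)"
    using lazy_prob_nonneg[OF p] by (intro sum_mono2) auto
  finally show ?thesis using t by (simp add: sum_lazy_prob[OF p] field_simps)
qed

text \<open>Above the threshold, a good residue has at least a twentieth of the maximal probability,
  and Markov's inequality bounds their number. Below it, the good residues form a sublevel set that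
  is \<open>m + 1\<close> times smaller than the half level, unless it is a single point;
  \<open>2 / \<alpha> < real p\<close> keeps the half level from being everything.\<close>

lemma card_good_steps:
  assumes p: "prime p" "odd p" and \<alpha>: "0 < \<alpha>" "2 / \<alpha> < real p" "lazy_prob p ws 0 \<ge> \<alpha>"
    and \<eta>: "\<eta> \<ge> 0" "real (3 * m + 1) ^ 2 * \<eta> \<le> 1 / 2"
    and \<Theta>: "\<Theta> > 0" "\<Theta> > 1 \<or> 20 / \<Theta> \<le> b"
    and b: "b \<ge> 1" "2 / (real (m + 1) * \<alpha>) \<le> b"
  shows "real (card {w \<in> {0..<int p}. good_step p \<Theta> \<eta> ws w}) \<le> b"
proof -
  have p0: "p > 0" using p by (simp add: prime_gt_0_nat)
  define r where "r = lazy_prob p ws 0"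
  have r: "r > 0" "r \<le> 1" "r \<ge> \<alpha>" using \<alpha> lazy_prob_0_le_1[OF p0 p(2)] by (auto simp: r_def)
  show ?thesis
  proof (cases "r \<ge> \<Theta>")
    case True
    have "{w \<in> {0..<int p}. good_step p \<Theta> \<eta> ws w} = {w \<in> {0..<int p}. lazy_prob p ws w \<ge> r / 20}"
      using True by (auto simp: good_step_def lazy_gap_def r_def)
    then have "real (card {w \<in> {0..<int p}. good_step p \<Theta> \<eta> ws w}) \<le> 1 / (r / 20)"
      using card_lazy_prob_ge[OF p0 p(2), of "r / 20" ws] r by simp
    also have "\<dots> \<le> 20 / \<Theta>" using True \<Theta> r by (simp add: frac_le)
    also have "\<dots> \<le> b" using True r \<Theta> by auto
    finally show ?thesis .
  next
    case False
    have half: "real (card {x \<in> {0..<int p}. lazy_gap p ws x \<le> r / 2}) \<le> 2 / r"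
    proof -
      have "{x \<in> {0..<int p}. lazy_gap p ws x \<le> r / 2} = {x \<in> {0..<int p}. lazy_prob p ws x \<ge> r / 2}"
        by (auto simp: lazy_gap_def r_def)
      then show ?thesis using card_lazy_prob_ge[OF p0 p(2), of "r / 2" ws] r by simp
    qed
    also have "2 / r \<le> 2 / \<alpha>" using r \<alpha> by (simp add: frac_le)
    finally have half': "real (card {x \<in> {0..<int p}. lazy_gap p ws x \<le> r / 2}) \<le> 2 / \<alpha>" .
    let ?A = "{x \<in> {0..<int p}. lazy_gap p ws x \<le> \<eta> * r}"
    have "card ?A = 1 \<or> (m + 1) * card ?A \<le> card {x \<in> {0..<int p}. lazy_gap p ws x \<le> r / 2}"
    proof (rule card_sublevel_growth)
      show "prime (int p)" using p by simp
      show "card {x \<in> {0..<int p}. lazy_gap p ws x \<le> r / 2} < nat (int p)"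
        using half' \<alpha>(2) by simp
    qed (use r \<eta> p0 in \<open>auto simp: lazy_gap_nonneg sqrt_lazy_gap_add, auto simp: lazy_gap_def lazy_prob_uminus lazy_prob_mod\<close>)
    then have "real (card ?A) \<le> b"
    proof
      assume "card ?A = 1" then show ?thesis using b by simp
    next
      assume "(m + 1) * card ?A \<le> card {x \<in> {0..<int p}. lazy_gap p ws x \<le> r / 2}"
      then have "real (m + 1) * real (card ?A) \<le> 2 / \<alpha>"
        using half' unfolding of_nat_mult[symmetric] by linarith
      then have "real (card ?A) \<le> 2 / (real (m + 1) * \<alpha>)"
        using pos_le_divide_eq[of "real (m + 1)" "real (card ?A)" "2 / \<alpha>"]
        by (simp add: mult.commute)
      then show ?thesis using b by linarith
    qed
    moreover have "{w \<in> {0..<int p}. good_step p \<Theta> \<eta> ws w} = ?A"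
      using False by (auto simp: good_step_def r_def)
    ultimately show ?thesis by simp
  qed
qed

text \<open>Concentrated vectors have a large lazy return probability, hence few bad steps:
  \<open>e\<close> must dominate every split \<open>a + c\<close> whose decay is compatible with a
  final value of at least \<open>\<alpha>\<close>.\<close>

lemma card_concentrated:
  assumes p: "prime p" "odd p" and \<alpha>: "0 < \<alpha>" "2 / \<alpha> < real p"
    and \<eta>: "0 \<le> \<eta>" "real (3 * m + 1) ^ 2 * \<eta> \<le> 1 / 2"
    and \<Theta>: "\<Theta> > 0" "\<Theta> > 1 \<or> 20 / \<Theta> \<le> b"
    and b: "b \<ge> 1" "2 / (real (m + 1) * \<alpha>) \<le> b"
    and \<kappa>: "0 < \<kappa>" "\<kappa> \<le> 1"
    and e: "\<And>a c. a = 0 \<or> \<Theta> \<le> 1 \<and> \<alpha> \<le> (61 / 80) ^ a \<Longrightarrow> c = 0 \<or> \<alpha> \<le> \<Theta> * (1 - \<eta> / 4) ^ c \<Longrightarrow> a + c \<le> e"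
  shows "real (card {ws. length ws = n \<and> set ws \<subseteq> {0..<int p} \<and> sign_prob (int p) ws \<ge> \<alpha>})
       \<le> (1 + \<kappa>) ^ n * (real p / \<kappa>) ^ e * b ^ (n - e)"
proof -
  have p0: "p > 0" using p by (simp add: prime_gt_0_nat)
  have "1 * \<eta> \<le> real (3 * m + 1) ^ 2 * \<eta>"
    using \<eta> by (intro mult_right_mono one_le_power) auto
  then have \<eta>1: "\<eta> \<le> 1" using \<eta> by linarith
  define G where "G = good_step p \<Theta> \<eta>"
  define alive where "alive ws \<longleftrightarrow> lazy_prob p ws 0 \<ge> \<alpha>" for ws
  have "{ws. length ws = n \<and> set ws \<subseteq> {0..<int p} \<and> sign_prob (int p) ws \<ge> \<alpha>} \<subseteq>
        {ws. length ws = n \<and> set ws \<subseteq> {0..<int p} \<and> (alive ws \<and> bad_count G ws \<le> e)}"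
  proof safe
    fix ws assume ws: "sign_prob (int p) ws \<ge> \<alpha>"
    then show "alive ws"
      using sign_prob_le_lazy_prob[OF p0, of ws] by (simp add: alive_def)
    then have al: "\<alpha> \<le> lazy_prob p ws 0" by (simp add: alive_def)
    obtain a c where ac: "bad_count G ws = a + c" "lazy_prob p ws 0 \<le> (61 / 80) ^ a"
       "a = 0 \<or> \<Theta> \<le> 1" "c = 0 \<or> lazy_prob p ws 0 \<le> \<Theta> * (1 - \<eta> / 4) ^ c"
      unfolding G_def using bad_count_bound[OF p0 p(2) \<eta>(1) \<eta>1 \<Theta>(1)] by blast
    have "a + c \<le> e" using ac al by (intro e) auto
    then show "bad_count G ws \<le> e" using ac by simp
  qed
  then have "real (card {ws. length ws = n \<and> set ws \<subseteq> {0..<int p} \<and> sign_prob (int p) ws \<ge> \<alpha>}) \<le>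
     real (card {ws. length ws = n \<and> set ws \<subseteq> {0..<int p} \<and> (alive ws \<and> bad_count G ws \<le> e)})"
    by (intro of_nat_mono card_mono finite_bounded_lists) auto
  also have "\<dots> \<le> (1 + \<kappa>) ^ n * (real p / \<kappa>) ^ e * b ^ (n - e)"
  proof (rule card_few_bad)
    show "alive ws" if "alive (w # ws)" for w ws
      using that lazy_prob_Cons_le[of p w ws] by (simp add: alive_def)
    show "real (card {w \<in> {0..<int p}. G ws w}) \<le> b" if "alive ws" for ws
      unfolding G_def using that by (intro card_good_steps[OF p \<alpha> _ \<eta> \<Theta> b]) (simp add: alive_def)
  qed (use p0 \<kappa> b in auto)
  finally show ?thesis .
qed

section \<open>Primes in short windows\<close>

lemma prod_primes_dvd:
  fixes N :: nat
  assumes "finite S" "\<And>p. p \<in> S \<Longrightarrow> prime p" "\<And>p. p \<in> S \<Longrightarrow> p dvd N"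
  shows "\<Prod>S dvd N"
  using assms
proof (induction S rule: finite_induct)
  case (insert q S)
  have "coprime q (\<Prod>S)"
    using insert.prems insert.hyps
    by (intro prod_coprime_right primes_coprime) auto
  moreover have "\<Prod>S dvd N" using insert by blast
  ultimately have "q * \<Prod>S dvd N"
    using insert.prems by (intro divides_mult) auto
  then show ?case using insert.hyps by simp
qed simp

section \<open>Chebyshev's estimates\<close>

lemma finite_primes_le [simp]: "finite {p::nat. prime p \<and> p \<le> n}"
  by (rule finite_subset[of _ "{..n}"]) auto

lemma middle_binomial_odd_le: "(2 * m + 1) choose m \<le> 4 ^ m"
proof -
  have "2 * ((2 * m + 1) choose m) = (\<Sum>k\<in>{m, m + 1}. (2 * m + 1) choose k)"
    using binomial_symmetric[of m "2 * m + 1"] by simp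
  also have "\<dots> \<le> (\<Sum>k\<le>2 * m + 1. (2 * m + 1) choose k)"
    by (rule sum_mono2) auto
  also have "\<dots> = 2 ^ (2 * m + 1)" by (rule choose_row_sum)
  also have "\<dots> = 2 * 4 ^ m" by (simp add: power_mult)
  finally show ?thesis by simp
qed

text \<open>Erdos' induction: for \<open>n = 2 * m + 1\<close> the primes in
  \<open>(m + 1, n]\<close> all divide \<open>n choose m\<close>, which is at most
  \<open>4 ^ m\<close>; an even \<open>n > 2\<close> contributes no new prime.\<close>

lemma prod_primes_le: "\<Prod>{p::nat. prime p \<and> p \<le> n} \<le> 4 ^ n"
proof (induction n rule: less_induct)
  case (less n)
  have "n \<le> 2 \<or> (n > 2 \<and> even n) \<or> (\<exists>m. n = 2 * m + 1 \<and> m \<ge> 1)" by presburger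
  then consider "n \<le> 2" | "n > 2" "even n" | m where "n = 2 * m + 1" "m \<ge> 1" by blast
  then show ?case
  proof cases
    case 1
    have "{p::nat. prime p \<and> p \<le> n} \<subseteq> {2}"
      using 1 by (auto dest!: prime_ge_2_nat)
    then have "{p::nat. prime p \<and> p \<le> n} = {} \<or> {p::nat. prime p \<and> p \<le> n} = {2}" by blast
    then show ?thesis
    proof
      assume eq: "{p::nat. prime p \<and> p \<le> n} = {2}"
      then have "n \<ge> 2" by auto
      then have "(4::nat) ^ 2 \<le> 4 ^ n" by (intro power_increasing) auto
      then show ?thesis unfolding eq by simp
    next
      assume eq: "{p::nat. prime p \<and> p \<le> n} = {}"
      show ?thesis unfolding eq by simp
    qed
  next
    case 2
    then have "\<not> prime n" using prime_odd_nat by auto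
    then have "{p::nat. prime p \<and> p \<le> n} = {p. prime p \<and> p \<le> n - 1}"
      using 2 by (auto simp: order.order_iff_strict)
    then have "\<Prod>{p::nat. prime p \<and> p \<le> n} \<le> 4 ^ (n - 1)" using less.IH[of "n - 1"] 2 by simp
    also have "\<dots> \<le> 4 ^ n" by (intro power_increasing) auto
    finally show ?thesis .
  next
    case 3
    define S where "S = {p::nat. prime p \<and> m + 1 < p \<and> p \<le> n}"
    have finS: "finite S" by (rule finite_subset[of _ "{..n}"]) (auto simp: S_def)
    have "\<Prod>S dvd (n choose m)"
    proof (rule prod_primes_dvd[OF finS])
      fix p assume p: "p \<in> S"
      then show "prime p" by (simp add: S_def)
      have "p dvd fact n" using p by (simp add: S_def prime_dvd_fact_iff)
      then have "p dvd fact m * fact (n - m) * (n choose m)"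
        using binomial_fact_lemma[of m n] 3 by simp
      moreover have "\<not> p dvd fact m" "\<not> p dvd fact (n - m)"
        using p 3 by (subst prime_dvd_fact_iff; force simp: S_def)+
      ultimately show "p dvd (n choose m)"
        using p by (auto simp: S_def prime_dvd_mult_iff)
    qed
    then have "\<Prod>S \<le> (n choose m)" using 3 by (intro dvd_imp_le) auto
    also have "\<dots> \<le> 4 ^ m" using middle_binomial_odd_le 3 by simp
    finally have S: "\<Prod>S \<le> 4 ^ m" .
    have "{p::nat. prime p \<and> p \<le> n} = {p. prime p \<and> p \<le> m + 1} \<union> S"
      using 3 by (auto simp: S_def)
    then have "\<Prod>{p::nat. prime p \<and> p \<le> n} = \<Prod>{p. prime p \<and> p \<le> m + 1} * \<Prod>S"
      using finS by (simp only:) (rule prod.union_disjoint, auto simp: S_def)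
    also have "\<dots> \<le> 4 ^ (m + 1) * 4 ^ m"
      using less.IH[of "m + 1"] S 3 by (intro mult_le_mono) auto
    also have "\<dots> = 4 ^ n" using 3 by (simp add: power_add mult_2)
    finally show ?thesis .
  qed
qed

text \<open>The entries \<open>1 / (k * (n choose k))\<close> of Leibniz' harmonic triangle satisfy a subtractive
  recursion starting from \<open>1 / n\<close>.\<close>
lemma leibniz_triangle_Ints:
  assumes "1 \<le> k" "k \<le> n" "\<And>j. 1 \<le> j \<Longrightarrow> j \<le> n \<Longrightarrow> j dvd d"
  shows "real d / (real k * real (n choose k)) \<in> \<int>"
  using assms
proof (induction k arbitrary: n rule: nat_induct_at_least)
  case base
  then obtain c where "d = n * c" using base.prems(2)[of n] by blast
  then show ?case using base by simp
next
  case (Suc k)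
  then obtain n' where n: "n = Suc n'" by (cases n) auto
  have k: "k \<le> n'" "1 \<le> k" using Suc n by auto
  define C where "C = real (n choose k)"
  have C: "C > 0" using k n by (simp add: C_def)
  have nk: "real n - real k > 0" using k n by simp
  have 1: "real (Suc k) * real (n choose Suc k) = (real n - real k) * C"
  proof -
    have "Suc k * (n choose Suc k) = (n - k) * (n choose k)"
      by (rule trans[OF binomial_absorption binomial_absorb_comp[symmetric]])
    then have "real (Suc k) * real (n choose Suc k) = real (n - k) * real (n choose k)"
      by (metis of_nat_mult)
    then show ?thesis using k n by (simp add: C_def of_nat_diff)
  qed
  have 2: "real n * real (n' choose k) = (real n - real k) * C"
  proof -
    have "(n - k) * (n choose k) = n * (n' choose k)"
      using binomial_absorb_comp[of n k] n by simp
    then have "real (n - k) * real (n choose k) = real n * real (n' choose k)"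
      by (metis of_nat_mult)
    then show ?thesis using k n by (simp add: C_def of_nat_diff)
  qed
  have E: "real (n' choose k) = (real n - real k) * C / real n"
    using 2 n by (simp add: field_simps)
  have ne: "real n \<noteq> real k" "real n \<noteq> 0" "real k \<noteq> 0" "C \<noteq> 0" using nk k n C by auto
  have "real d / (real k * real (n' choose k)) - real d / (real k * C)
      = real d / (real k * C) * (real n / (real n - real k) - 1)"
    unfolding E using ne by (simp add: field_simps)
  also have "\<dots> = real d / ((real n - real k) * C)"
    using ne by (simp add: divide_simps)
  also have "\<dots> = real d / (real (Suc k) * real (n choose Suc k))" using 1 by simp
  finally have "real d / (real (Suc k) * real (n choose Suc k)) =
      real d / (real k * real (n' choose k)) - real d / (real k * real (n choose k))"
    by (simp add: C_def)
  moreover have "real d / (real k * real (n' choose k)) \<in> \<int>"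
    using Suc k n by (intro Suc.IH) auto
  moreover have "real d / (real k * real (n choose k)) \<in> \<int>"
    using Suc k n by (intro Suc.IH) auto
  ultimately show ?case by simp
qed

text \<open>A positive integer is at least 1; applied to the quotient from the harmonic triangle
  this gives even \<open>k * (n choose k) \<le> d\<close>.\<close>

lemma binomial_le_common_multiple:
  assumes "d > 0" "1 \<le> k" "k \<le> n" "\<And>j. 1 \<le> j \<Longrightarrow> j \<le> n \<Longrightarrow> j dvd d"
  shows "n choose k \<le> d"
proof -
  define q where "q = real d / (real k * real (n choose k))"
  have "q \<in> \<int>" unfolding q_def by (rule leibniz_triangle_Ints) (use assms in auto)
  moreover have pos: "real k * real (n choose k) > 0" using assms by simp
  then have "q > 0" using assms by (simp add: q_def)
  ultimately have "q \<ge> 1"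
    by (auto simp: Ints_def)
  then have "real k * real (n choose k) \<le> real d" using pos by (simp add: q_def field_simps)
  moreover have "1 * real (n choose k) \<le> real k * real (n choose k)"
    using assms by (intro mult_right_mono) auto
  ultimately show ?thesis by linarith
qed

lemma central_binomial_ge: "2 ^ m \<le> (2 * m) choose m"
proof (induction m)
  case (Suc m)
  have "2 * ((2 * m) choose m) \<le> (2 * Suc m) choose Suc m"
  proof -
    have "(2 * Suc m) choose Suc m = (Suc (2 * m) choose m) + (Suc (2 * m) choose Suc m)"
      by simp
    moreover have "Suc (2 * m) choose m = Suc (2 * m) choose Suc m"
      using binomial_symmetric[of m "Suc (2 * m)"] by simp
    moreover have "(2 * m) choose m \<le> Suc (2 * m) choose Suc m" by simp
    ultimately show ?thesis by linarith
  qed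
  then show ?case using Suc by simp
qed simp

text \<open>The number \<open>d\<close> is the least common multiple of \<open>1..N\<close>, written
  through the largest prime powers up to \<open>N\<close>, and dominates a central binomial
  coefficient. Only primes with \<open>p * p \<le> N\<close> can have exponent above 1; there are at
  most \<open>sqrt N\<close> of them, each adding at most \<open>ln N\<close>.\<close>

lemma ln_primes_lower:
  assumes N: "N \<ge> 2"
  shows "real (N div 2) * ln 2 \<le> (\<Sum>p | prime p \<and> p \<le> N. ln (real p)) + sqrt (real N) * ln (real N)"
proof -
  define a where "a p = (GREATEST a. p ^ a \<le> N)" for p :: nat
  define PS where "PS = {p::nat. prime p \<and> p \<le> N}"
  have finPS: "finite PS" by (simp add: PS_def)
  have bound: "k \<le> N" if "prime p" "p ^ k \<le> N" for p k :: nat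
  proof -
    have "k < 2 ^ k" by simp
    also have "(2::nat) ^ k \<le> p ^ k" using that prime_ge_2_nat by (intro power_mono) auto
    finally show ?thesis using that by simp
  qed
  have a1: "p ^ a p \<le> N" if "prime p" for p
    unfolding a_def by (rule GreatestI_nat[of _ 0 N]) (use bound that N in auto)
  have a2: "k \<le> a p" if "prime p" "p ^ k \<le> N" for p k
    unfolding a_def by (rule Greatest_le_nat[of _ _ N]) (use bound that in auto)
  define d where "d = (\<Prod>p\<in>PS. p ^ a p)"
  have d0: "d > 0" by (auto simp: d_def PS_def prime_gt_0_nat intro!: prod_pos)
  have dvd: "j dvd d" if j: "1 \<le> j" "j \<le> N" for j
  proof -
    have "j = (\<Prod>p\<in>prime_factors j. p ^ multiplicity p j)"
      using j by (simp add: prod_prime_factors)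
    also have "\<dots> dvd (\<Prod>p\<in>prime_factors j. p ^ a p)"
    proof (rule prod_dvd_prod, rule le_imp_power_dvd)
      fix p assume p: "p \<in> prime_factors j"
      have "p ^ multiplicity p j \<le> j" using j by (intro dvd_imp_le multiplicity_dvd) auto
      then show "multiplicity p j \<le> a p" using p j by (intro a2) auto
    qed
    also have "\<dots> dvd d" unfolding d_def
    proof (rule prod_dvd_prod_subset[OF finPS])
      show "prime_factors j \<subseteq> PS"
      proof
        fix p assume p: "p \<in> prime_factors j"
        then have "p dvd j" by auto
        then have "p \<le> j" using j by (intro dvd_imp_le) auto
        then show "p \<in> PS" using p j by (auto simp: PS_def)
      qed
    qed
    finally show ?thesis .
  qed
  define m where "m = N div 2"
  have "2 ^ m \<le> (2 * m) choose m" by (rule central_binomial_ge)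
  also have "\<dots> \<le> d"
    by (rule binomial_le_common_multiple[OF d0]) (use N dvd in \<open>auto simp: m_def\<close>)
  finally have "ln (real (2 ^ m)) \<le> ln (real d)"
    using d0 by (subst ln_le_cancel_iff) auto
  then have "real m * ln 2 \<le> ln (real d)" by (simp add: ln_realpow)
  also have "\<dots> = (\<Sum>p\<in>PS. ln (real (p ^ a p)))"
    unfolding d_def of_nat_prod by (rule ln_prod[OF finPS]) (auto simp: PS_def prime_gt_0_nat)
  also have "\<dots> \<le> (\<Sum>p\<in>PS. ln (real p) + (if p * p \<le> N then ln (real N) else 0))"
  proof (rule sum_mono)
    fix p assume p: "p \<in> PS"
    then have pp: "prime p" "p > 0" "p \<ge> 2" by (auto simp: PS_def prime_gt_0_nat prime_ge_2_nat)
    show "ln (real (p ^ a p)) \<le> ln (real p) + (if p * p \<le> N then ln (real N) else 0)"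
    proof (cases "p * p \<le> N")
      case True
      have "ln (real (p ^ a p)) \<le> ln (real N)"
        using a1[OF pp(1)] pp N by (subst ln_le_cancel_iff) (auto simp del: of_nat_power)
      moreover have "ln (real p) \<ge> 0" using pp by simp
      ultimately show ?thesis using True by simp
    next
      case False
      have "a p \<le> 1"
      proof (rule ccontr)
        assume "\<not> a p \<le> 1"
        then have "p ^ 2 \<le> p ^ a p" using pp by (intro power_increasing) auto
        then show False using a1[OF pp(1)] False by (simp add: power2_eq_square)
      qed
      then have "p ^ a p \<le> p ^ 1" using pp by (intro power_increasing) auto
      then have "ln (real (p ^ a p)) \<le> ln (real p)"
        using pp by (subst ln_le_cancel_iff) (auto simp del: of_nat_power)
      then show ?thesis using False by simp
    qed
  qed
  also have "\<dots> = (\<Sum>p\<in>PS. ln (real p)) + real (card {p \<in> PS. p * p \<le> N}) * ln (real N)"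
    by (simp add: sum.distrib sum.If_cases finPS Int_def)
  also have "real (card {p \<in> PS. p * p \<le> N}) * ln (real N) \<le> sqrt (real N) * ln (real N)"
  proof (rule mult_right_mono)
    have "{p \<in> PS. p * p \<le> N} \<subseteq> {1..nat \<lfloor>sqrt (real N)\<rfloor>}"
    proof
      fix p assume p: "p \<in> {p \<in> PS. p * p \<le> N}"
      then have "real p ^ 2 \<le> real N" by (simp add: power2_eq_square flip: of_nat_mult)
      then have "real p \<le> sqrt (real N)" by (rule real_le_rsqrt)
      moreover have "p \<ge> 1" using p prime_ge_1_nat[of p] by (auto simp: PS_def)
      ultimately show "p \<in> {1..nat \<lfloor>sqrt (real N)\<rfloor>}" by (simp add: le_nat_floor)
    qed
    then have "card {p \<in> PS. p * p \<le> N} \<le> nat \<lfloor>sqrt (real N)\<rfloor>"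
      using card_mono[of "{1..nat \<lfloor>sqrt (real N)\<rfloor>}"] by simp
    then have "real (card {p \<in> PS. p * p \<le> N}) \<le> real (nat \<lfloor>sqrt (real N)\<rfloor>)" by (simp only: of_nat_le_iff)
    also have "\<dots> \<le> sqrt (real N)" by (rule of_nat_floor) simp
    finally show "real (card {p \<in> PS. p * p \<le> N}) \<le> sqrt (real N)" .
  qed (use N in simp)
  finally show ?thesis by (simp add: m_def PS_def)
qed

lemma ln_primes_upper: "(\<Sum>p::nat | prime p \<and> p \<le> n. ln (real p)) \<le> real n * ln 4"
proof -
  have "(\<Sum>p::nat | prime p \<and> p \<le> n. ln (real p)) = ln (real (\<Prod>{p::nat. prime p \<and> p \<le> n}))"
    unfolding of_nat_prod by (rule ln_prod[symmetric]) (auto simp: prime_gt_0_nat)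
  also have "\<dots> \<le> ln (real (4 ^ n))"
  proof (subst ln_le_cancel_iff)
    have "\<Prod>{p::nat. prime p \<and> p \<le> n} > 0" by (intro prod_pos) (auto simp: prime_gt_0_nat)
    then show "0 < real (\<Prod>{p::nat. prime p \<and> p \<le> n})" by (simp only: of_nat_0_less_iff)
    show "real (\<Prod>{p::nat. prime p \<and> p \<le> n}) \<le> real (4 ^ n)"
      using prod_primes_le[of n] of_nat_le_iff by blast
  qed simp
  finally show ?thesis by (simp add: ln_realpow)
qed

text \<open>All primes up to \<open>N\<close> give about \<open>N / 2 * ln 2\<close>, those up to
  \<open>N / 8\<close> at most \<open>N / 8 * ln 4 = N / 4 * ln 2\<close>. The ratio 8 of the window
  leaves room for these crude constants.\<close>

lemma eventually_many_primes:
  "\<forall>\<^sub>F N in sequentially. real N / 10 \<le> (\<Sum>p | prime p \<and> N < 8 * p \<and> p \<le> N. ln (real p))"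
proof -
  have "\<forall>\<^sub>F N :: nat in sequentially. real N / 10 \<le> (real N / 2 - 1 / 2) * (2 / 3) - sqrt (real N) * ln (real N) - real N / 4 * (25 / 36)"
    by real_asymp
  then show ?thesis using eventually_ge_at_top[of 2]
  proof eventually_elim
    case (elim N)
    have "(\<Sum>p | prime p \<and> p \<le> N. ln (real p)) = (\<Sum>p | prime p \<and> p \<le> N div 8. ln (real p)) + (\<Sum>p | prime p \<and> N < 8 * p \<and> p \<le> N. ln (real p))"
    proof (subst sum.union_disjoint[symmetric])
      show "finite {p. prime p \<and> N < 8 * p \<and> p \<le> N}"
        by (rule finite_subset[of _ "{..N}"]) auto
      show "(\<Sum>p | prime p \<and> p \<le> N. ln (real p)) = (\<Sum>p\<in>{p. prime p \<and> p \<le> N div 8} \<union> {p. prime p \<and> N < 8 * p \<and> p \<le> N}. ln (real p))"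
        by (rule sum.cong) auto
    qed auto
    moreover have "(\<Sum>p::nat | prime p \<and> p \<le> N div 8. ln (real p)) \<le> real N / 4 * (25 / 36)"
    proof -
      have "ln (4::real) = 2 * ln 2" using ln_realpow[of 2 2] by simp
      then have "real (N div 8) * ln 4 \<le> real N / 8 * (2 * (25 / 36))"
        using ln2_le_25_over_36 by (intro mult_mono) (linarith, linarith, simp_all)
      then show ?thesis using ln_primes_upper[of "N div 8"] by simp
    qed
    moreover have "(real N / 2 - 1 / 2) * (2 / 3) \<le> real (N div 2) * ln 2"
      using ln2_ge_two_thirds elim by (intro mult_mono) linarith+
    ultimately show ?case using ln_primes_lower[of N] elim by linarith
  qed
qed

text \<open>Averaging over the primes of the window with weights \<open>ln p\<close>: a nonzero
  signed sum of size at most \<open>B\<close> has prime divisors of total weight at most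
  \<open>ln B\<close>, while the window has weight at least \<open>N / 10\<close>. So some prime
  adds at most the quotient to the concentration.\<close>

lemma exists_good_prime:
  fixes v :: "int list" and B :: real
  assumes B: "B \<ge> 1" "\<And>xs. xs \<in> signs (length v) \<Longrightarrow> \<bar>real_of_int (dot xs v)\<bar> \<le> B"
    and N: "N > 0" "real N / 10 \<le> (\<Sum>p | prime p \<and> N < 8 * p \<and> p \<le> N. ln (real p))"
  shows "\<exists>p. prime p \<and> N < 8 * p \<and> p \<le> N \<and> sign_prob (int p) v \<le> sign_prob 0 v + 10 * ln B / real N"
proof (rule ccontr)
  assume contr: "\<nexists>p. prime p \<and> N < 8 * p \<and> p \<le> N \<and> sign_prob (int p) v \<le> sign_prob 0 v + 10 * ln B / real N"
  define PS where "PS = {p. prime p \<and> N < 8 * p \<and> p \<le> N}"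
  have finPS: "finite PS" by (rule finite_subset[of _ "{..N}"]) (auto simp: PS_def)
  define n where "n = length v"
  define X where "X = {xs \<in> signs n. dot xs v \<noteq> 0}"
  have finX: "finite X" by (simp add: X_def)
  \<comment> \<open>The excess modulo \<open>p\<close> counts the sign vectors whose signed sum is
    nonzero but divisible by \<open>p\<close>.\<close>
  have diff: "sign_prob (int p) v - sign_prob 0 v = card {xs \<in> X. int p dvd dot xs v} / 2 ^ n" for p
  proof -
    have "{xs \<in> signs n. int p dvd dot xs v} = {xs \<in> X. int p dvd dot xs v} \<union> {xs \<in> signs n. 0 dvd dot xs v}"
      by (auto simp: X_def)
    then have "card {xs \<in> signs n. int p dvd dot xs v} = card {xs \<in> X. int p dvd dot xs v} + card {xs \<in> signs n. 0 dvd dot xs v}"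
      by (simp only:) (rule card_Un_disjoint, auto simp: X_def)
    then show ?thesis by (simp add: sign_prob_def n_def field_simps)
  qed
  have each: "(\<Sum>p | p \<in> PS \<and> int p dvd dot xs v. ln (real p)) \<le> ln B" if xs: "xs \<in> X" for xs
  proof -
    define z where "z = nat \<bar>dot xs v\<bar>"
    have z: "z > 0" using xs by (simp add: z_def X_def)
    define S where "S = {p. p \<in> PS \<and> int p dvd dot xs v}"
    have S: "finite S" "\<And>p. p \<in> S \<Longrightarrow> prime p" using finPS by (auto simp: S_def PS_def)
    have "\<Prod>S dvd z"
    proof (rule prod_primes_dvd[OF S])
      fix p assume "p \<in> S"
      then have "int p dvd int z" by (simp add: S_def z_def)
      then show "p dvd z" by simp
    qed
    then have "\<Prod>S \<le> z" using z by (intro dvd_imp_le) auto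
    then have le: "real (\<Prod>S) \<le> real z" by (simp only: of_nat_le_iff)
    have pos: "real (\<Prod>S) > 0" unfolding of_nat_prod using S by (intro prod_pos) (auto simp: prime_gt_0_nat)
    have "(\<Sum>p\<in>S. ln (real p)) = ln (real (\<Prod>S))"
      unfolding of_nat_prod by (rule ln_prod[symmetric]) (use S in \<open>auto simp: prime_gt_0_nat\<close>)
    also have "\<dots> \<le> ln (real z)" using le pos by (subst ln_le_cancel_iff) auto
    also have "\<dots> \<le> ln B"
      using B(2)[of xs] B(1) z xs by (subst ln_le_cancel_iff) (auto simp: z_def X_def n_def)
    finally show ?thesis by (simp add: S_def)
  qed
  have pos: "(\<Sum>p\<in>PS. ln (real p)) > 0" using N by (simp add: PS_def)
  have lnp: "ln (real p) > 0" if "p \<in> PS" for p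
    using that prime_gt_1_nat[of p] by (auto simp: PS_def)
  have "ln B = real N / 10 * (10 * ln B / real N)" using N(1) by simp
  also have "\<dots> \<le> (\<Sum>p\<in>PS. ln (real p)) * (10 * ln B / real N)"
    using N(2) B(1) by (intro mult_right_mono) (auto simp: PS_def)
  also have "\<dots> = (\<Sum>p\<in>PS. ln (real p) * (10 * ln B / real N))" by (rule sum_distrib_right)
  also have "\<dots> < (\<Sum>p\<in>PS. ln (real p) * (sign_prob (int p) v - sign_prob 0 v))"
  proof (rule sum_strict_mono)
    show "PS \<noteq> {}" using pos by auto
    show "ln (real p) * (10 * ln B / real N) < ln (real p) * (sign_prob (int p) v - sign_prob 0 v)" if p: "p \<in> PS" for p
      using contr p lnp[OF p] by (intro mult_strict_left_mono) (auto simp: PS_def not_le)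
  qed (rule finPS)
  also have "\<dots> = (\<Sum>p\<in>PS. \<Sum>xs\<in>X. if int p dvd dot xs v then ln (real p) / 2 ^ n else 0)"
    by (intro sum.cong refl) (simp add: diff sum.If_cases finX Int_def)
  also have "\<dots> = (\<Sum>xs\<in>X. \<Sum>p\<in>PS. if int p dvd dot xs v then ln (real p) / 2 ^ n else 0)"
    by (rule sum.swap)
  also have "\<dots> = (\<Sum>xs\<in>X. (\<Sum>p | p \<in> PS \<and> int p dvd dot xs v. ln (real p)) / 2 ^ n)"
    by (intro sum.cong refl) (simp add: sum.If_cases finPS Int_def sum_divide_distrib)
  also have "\<dots> \<le> (\<Sum>xs\<in>X. ln B / 2 ^ n)"
    by (intro sum_mono divide_right_mono each) auto
  also have "\<dots> \<le> (\<Sum>xs\<in>signs n. ln B / 2 ^ n)"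
    using B(1) by (intro sum_mono2) (auto simp: X_def)
  also have "\<dots> = ln B" by simp
  finally show False by simp
qed

section \<open>Dependent rows of sign matrices\<close>

lemma dot_diff:
  "length u = length v \<Longrightarrow> dot xs (map2 (-) u v) = dot xs u - dot xs v"
proof (induction u v arbitrary: xs rule: list_induct2)
  case (Cons a u b v)
  then show ?case by (cases xs) (auto simp: algebra_simps)
qed simp

lemma dot_conv_sum:
  "length xs = n \<Longrightarrow> length v = n \<Longrightarrow> dot xs v = (\<Sum>k<n. xs ! k * v ! k)"
  by (simp add: dot_def sum_list_sum_nth lessThan_atLeast0)

lemma abs_dot_signs_le:
  assumes "xs \<in> signs (length v)" "\<And>x. x \<in> set v \<Longrightarrow> \<bar>x\<bar> \<le> B"
  shows "\<bar>dot xs v\<bar> \<le> int (length v) * B"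
proof -
  have xs: "length xs = length v" "set xs \<subseteq> {-1, 1}" using assms by (auto simp: signs_def)
  have "\<bar>dot xs v\<bar> \<le> (\<Sum>k<length v. \<bar>xs ! k * v ! k\<bar>)"
    using dot_conv_sum[OF xs(1) refl] by (simp add: sum_abs)
  also have "\<dots> \<le> (\<Sum>k<length v. B)"
  proof (rule sum_mono)
    fix k assume k: "k \<in> {..<length v}"
    then have "xs ! k \<in> set xs" using xs by simp
    then have "xs ! k \<in> {-1, 1}" using xs(2) by blast
    moreover have "\<bar>v ! k\<bar> \<le> B" using k assms(2) by auto
    ultimately show "\<bar>xs ! k * v ! k\<bar> \<le> B" by (auto simp: abs_mult)
  qed
  finally show ?thesis by simp
qed

text \<open>Pigeonhole: the box \<open>{0..B}\<close> has more integer points than the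
  \<open>n - 1\<close> dot products have joint values, so two points agree in all of them, and their
  difference is the vector.\<close>

lemma siegel_kernel_vector:
  assumes n: "n \<ge> 1" and J: "finite J" "card J = n - 1" and R: "\<And>j. j \<in> J \<Longrightarrow> R j \<in> signs n"
  shows "\<exists>v. length v = n \<and> (\<exists>x\<in>set v. x \<noteq> 0) \<and> (\<forall>x\<in>set v. \<bar>x\<bar> \<le> (2 * int n + 1) ^ n) \<and> (\<forall>j\<in>J. dot (R j) v = 0)"
proof -
  define B where "B = (2 * int n + 1) ^ n"
  have B: "B > 0" by (simp add: B_def)
  define U where "U = {u. set u \<subseteq> {0..B} \<and> length u = n}"
  define f where "f u = restrict (\<lambda>j. dot (R j) u) J" for u
  define K where "K = {- int n * B..int n * B}"
  have "finite U" by (simp add: U_def finite_lists_length_eq)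
  have card_U: "card U = (nat B + 1) ^ n"
    using B by (simp add: U_def card_lists_length_eq nat_add_distrib)
  have card_K: "card K = 2 * n * nat B + 1"
    using B by (simp add: K_def nat_mult_distrib nat_add_distrib)
  have f: "f ` U \<subseteq> J \<rightarrow>\<^sub>E K"
  proof (rule image_subsetI)
    fix u assume u: "u \<in> U"
    have "dot (R j) u \<in> K" if "j \<in> J" for j
    proof -
      have "\<bar>dot (R j) u\<bar> \<le> int (length u) * B"
        using u R[OF that] by (intro abs_dot_signs_le) (auto simp: U_def)
      then show ?thesis using u by (auto simp: K_def U_def abs_le_iff)
    qed
    then show "f u \<in> J \<rightarrow>\<^sub>E K" by (auto simp: f_def)
  qed
  have "\<not> inj_on f U"
  proof
    assume "inj_on f U"
    then have "card U \<le> card (J \<rightarrow>\<^sub>E K)"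
      using f J by (intro card_inj_on_le[of f]) (auto simp: K_def intro!: finite_PiE)
    also have "card (J \<rightarrow>\<^sub>E K) = (2 * n * nat B + 1) ^ (n - 1)"
      using J by (simp add: card_PiE card_K)
    also have "\<dots> \<le> ((2 * n + 1) * (nat B + 1)) ^ (n - 1)"
      by (intro power_mono) (auto simp: algebra_simps)
    also have "\<dots> = (2 * n + 1) ^ (n - 1) * (nat B + 1) ^ (n - 1)" by (rule power_mult_distrib)
    \<comment> \<open>This inequality dictates the size of \<open>B\<close>.\<close>
    also have "(2 * n + 1) ^ (n - 1) < nat B + 1"
    proof -
      have "int ((2 * n + 1) ^ (n - 1)) \<le> B"
        unfolding B_def by (simp add: add.commute) (intro power_increasing, auto)
      then show ?thesis by linarith
    qed
    then have "(2 * n + 1) ^ (n - 1) * (nat B + 1) ^ (n - 1) < (nat B + 1) * (nat B + 1) ^ (n - 1)"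
      by (intro mult_strict_right_mono) auto
    also have "\<dots> = (nat B + 1) ^ n" using n by (cases n) auto
    finally show False using card_U by simp
  qed
  then obtain u u' where uu: "u \<in> U" "u' \<in> U" "u \<noteq> u'" "f u = f u'" by (auto simp: inj_on_def)
  have len: "length u = n" "length u' = n" using uu by (auto simp: U_def)
  define v where "v = map2 (-) u u'"
  have lv: "length v = n" using len by (simp add: v_def)
  have nth: "v ! k = u ! k - u' ! k" if "k < n" for k using that len by (simp add: v_def)
  have "\<exists>x\<in>set v. x \<noteq> 0"
  proof -
    obtain k where k: "k < n" "u ! k \<noteq> u' ! k" using uu(3) len by (metis nth_equalityI)
    then have "v ! k \<noteq> 0" using nth[of k] by simp
    moreover have "v ! k \<in> set v" using k lv by simp
    ultimately show ?thesis by blast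
  qed
  moreover have "\<bar>x\<bar> \<le> B" if x: "x \<in> set v" for x
  proof -
    obtain k where k: "k < n" "x = v ! k" using x lv by (metis in_set_conv_nth)
    have "u ! k \<in> set u" "u' ! k \<in> set u'" using k len by simp_all
    moreover have "set u \<subseteq> {0..B}" "set u' \<subseteq> {0..B}" using uu by (simp_all add: U_def)
    ultimately have "u ! k \<in> {0..B}" "u' ! k \<in> {0..B}" by blast+
    then show ?thesis using nth k by auto
  qed
  moreover have "dot (R j) v = 0" if "j \<in> J" for j
  proof -
    have "dot (R j) u = dot (R j) u'" using fun_cong[OF uu(4), of j] that by (simp add: f_def)
    then show ?thesis using len by (simp add: v_def dot_diff)
  qed
  ultimately show ?thesis using lv unfolding B_def by blast
qed

text \<open>The coefficients are real because they will come from a kernel vector of the transposed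
  real matrix.\<close>

definition dependent_rows :: "nat \<Rightarrow> (nat \<Rightarrow> int list) \<Rightarrow> bool" where
  "dependent_rows n R \<longleftrightarrow>
     (\<exists>c::nat \<Rightarrow> real. (\<exists>i<n. c i \<noteq> 0) \<and> (\<forall>k<n. (\<Sum>i<n. c i * of_int (R i ! k)) = 0))"

text \<open>A row with nonzero coefficient is a combination of the others, so orthogonality passes
  to it. The index depends on the matrix only, not on \<open>v\<close>.\<close>

lemma dependent_rows_imp:
  assumes "dependent_rows n R" "\<And>i. i < n \<Longrightarrow> length (R i) = n"
  shows "\<exists>i<n. \<forall>v. length v = n \<longrightarrow> (\<forall>j\<in>{..<n} - {i}. dot (R j) v = 0) \<longrightarrow> dot (R i) v = 0"
proof -
  obtain c i where c: "i < n" "c i \<noteq> 0" "\<And>k. k < n \<Longrightarrow> (\<Sum>i<n. c i * real_of_int (R i ! k)) = 0"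
    using assms(1) by (auto simp: dependent_rows_def)
  have "dot (R i) v = 0" if v: "length v = n" "\<forall>j\<in>{..<n} - {i}. dot (R j) v = 0" for v
  proof -
    have "0 = (\<Sum>k<n. (\<Sum>j<n. c j * real_of_int (R j ! k)) * of_int (v ! k))"
      using c(3) by simp
    also have "\<dots> = (\<Sum>k<n. \<Sum>j<n. c j * (real_of_int (R j ! k) * of_int (v ! k)))"
      by (simp add: sum_distrib_right mult.assoc)
    also have "\<dots> = (\<Sum>j<n. \<Sum>k<n. c j * (real_of_int (R j ! k) * of_int (v ! k)))"
      by (rule sum.swap)
    also have "\<dots> = (\<Sum>j<n. c j * of_int (dot (R j) v))"
    proof (rule sum.cong)
      fix j assume "j \<in> {..<n}"
      then have "dot (R j) v = (\<Sum>k<n. R j ! k * v ! k)"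
        using assms(2) v by (intro dot_conv_sum) auto
      then show "(\<Sum>k<n. c j * (real_of_int (R j ! k) * of_int (v ! k))) = c j * of_int (dot (R j) v)"
        by (simp add: sum_distrib_left)
    qed simp
    also have "\<dots> = c i * of_int (dot (R i) v) + (\<Sum>j\<in>{..<n} - {i}. c j * of_int (dot (R j) v))"
      using c(1) by (subst sum.remove[of _ i]) auto
    also have "(\<Sum>j\<in>{..<n} - {i}. c j * of_int (dot (R j) v)) = 0"
      using v(2) by (intro sum.neutral) auto
    finally show ?thesis using c(2) by simp
  qed
  then show ?thesis using c(1) by blast
qed

section \<open>Counting sign matrices with dependent rows\<close>

lemma dvd_dot_mod:
  "p dvd dot xs (map (\<lambda>x. x mod p) v) \<longleftrightarrow> p dvd dot xs v"
proof -
  have "[dot xs (map (\<lambda>x. x mod p) v) = dot xs v] (mod p)"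
  proof (induction v arbitrary: xs)
    case (Cons a v)
    then show ?case by (cases xs) (auto simp: cong_def intro!: mod_add_cong mod_mult_cong)
  qed simp
  then show ?thesis by (rule cong_dvd_iff)
qed

lemma sign_prob_mod: "sign_prob p (map (\<lambda>x. x mod p) v) = sign_prob p v"
  by (simp add: sign_prob_def dvd_dot_mod)

lemma card_signs_dvd: "length w = n \<Longrightarrow> real (card {x \<in> signs n. p dvd dot x w}) = 2 ^ n * sign_prob p w"
  by (auto simp: sign_prob_def)

text \<open>There are \<open>n\<close> candidates for the redundant row. Given the others, it is
  orthogonal to their kernel vector with probability at most \<open>t\<close>, unless that vector is
  concentrated. In that case some pair \<open>(p, w)\<close> in \<open>T\<close> has all
  \<open>n - 1\<close> other rows orthogonal to \<open>w\<close> modulo \<open>p\<close>, and these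
  rows are independent.\<close>

lemma card_dependent_rows_le:
  fixes t :: real and T :: "(int \<times> int list) set"
  assumes n: "n \<ge> 1" and t: "t \<ge> 0" and T: "finite T" "\<And>p w. (p, w) \<in> T \<Longrightarrow> length w = n"
    and cover: "\<And>v. length v = n \<Longrightarrow> \<exists>x\<in>set v. x \<noteq> 0 \<Longrightarrow> \<forall>x\<in>set v. \<bar>x\<bar> \<le> (2 * int n + 1) ^ n \<Longrightarrow>
       sign_prob 0 v > t \<Longrightarrow> \<exists>p. (p, map (\<lambda>x. x mod p) v) \<in> T"
  shows "real (card {R \<in> {..<n} \<rightarrow>\<^sub>E signs n. dependent_rows n R}) \<le>
           2 ^ (n * n) * (real n * (t + (\<Sum>(p, w)\<in>T. sign_prob p w ^ (n - 1))))"
proof -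
  define Z where "Z = {R \<in> {..<n} \<rightarrow>\<^sub>E signs n. dependent_rows n R}"
  define I where "I i = {..<n} - {i}" for i
  have cI: "finite (I i)" "i < n \<Longrightarrow> card (I i) = n - 1" for i by (auto simp: I_def)
  have "\<exists>v. length v = n \<and> (\<exists>x\<in>set v. x \<noteq> 0) \<and> (\<forall>x\<in>set v. \<bar>x\<bar> \<le> (2 * int n + 1) ^ n) \<and> (\<forall>j\<in>I i. dot (R j) v = 0)"
    if "i < n" "R \<in> I i \<rightarrow>\<^sub>E signs n" for i R
    using that cI by (intro siegel_kernel_vector[OF n]) auto
  \<comment> \<open>A kernel vector is fixed for each choice of the other rows before row
    \<open>i\<close> is seen, which keeps the two independent.\<close>
  then obtain kv where kv: "\<And>i R. i < n \<Longrightarrow> R \<in> I i \<rightarrow>\<^sub>E signs n \<Longrightarrow>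
     length (kv i R) = n \<and> (\<exists>x\<in>set (kv i R). x \<noteq> 0) \<and> (\<forall>x\<in>set (kv i R). \<bar>x\<bar> \<le> (2 * int n + 1) ^ n) \<and>
     (\<forall>j\<in>I i. dot (R j) (kv i R) = 0)" by metis
  define W where "W i = (SIGMA R : I i \<rightarrow>\<^sub>E signs n. {x \<in> signs n. dot x (kv i R) = 0})" for i
  have finP: "finite (I i \<rightarrow>\<^sub>E signs n)" for i using cI by (intro finite_PiE) auto
  have finW: "finite (W i)" for i unfolding W_def using finP by (intro finite_SigmaI) auto
  have "Z \<subseteq> (\<Union>i<n. (\<lambda>(R, x). R(i := x)) ` W i)"
  proof
    fix R assume R: "R \<in> Z"
    then have R': "R \<in> {..<n} \<rightarrow>\<^sub>E signs n" "dependent_rows n R" by (auto simp: Z_def)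
    then obtain i where i: "i < n" "\<And>v. length v = n \<Longrightarrow> (\<forall>j\<in>I i. dot (R j) v = 0) \<Longrightarrow> dot (R i) v = 0"
      using dependent_rows_imp[of n R] by (auto simp: I_def signs_def PiE_iff)
    define R0 where "R0 = restrict R (I i)"
    have R0: "R0 \<in> I i \<rightarrow>\<^sub>E signs n" using R' by (auto simp: R0_def I_def)
    have "dot (R i) (kv i R0) = 0"
      using kv[OF i(1) R0] by (intro i(2)) (auto simp: R0_def)
    then have "(R0, R i) \<in> W i" using R0 R' i(1) by (auto simp: W_def)
    moreover have "R = R0(i := R i)"
    proof
      fix j show "R j = (R0(i := R i)) j"
        using R'(1) by (auto simp: R0_def I_def PiE_iff extensional_def restrict_def)
    qed
    ultimately show "R \<in> (\<Union>i<n. (\<lambda>(R, x). R(i := x)) ` W i)"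
      using i(1) by (intro UN_I[of i] image_eqI[of _ _ "(R0, R i)"]) auto
  qed
  then have "card Z \<le> card (\<Union>i<n. (\<lambda>(R, x). R(i := x)) ` W i)"
    using finW by (intro card_mono) auto
  also have "\<dots> \<le> (\<Sum>i<n. card ((\<lambda>(R, x). R(i := x)) ` W i))"
    by (rule card_UN_le) simp
  also have "\<dots> \<le> (\<Sum>i<n. card (W i))"
    by (intro sum_mono card_image_le finW)
  finally have "real (card Z) \<le> (\<Sum>i<n. real (card (W i)))"
    unfolding of_nat_sum[symmetric] of_nat_le_iff .
  also have "\<dots> \<le> (\<Sum>i<n. 2 ^ (n * n) * (t + (\<Sum>(p, w)\<in>T. sign_prob p w ^ (n - 1))))"
  proof (rule sum_mono)
    fix i assume "i \<in> {..<n}"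
    then have i: "i < n" by simp
    define P where "P = I i \<rightarrow>\<^sub>E signs n"
    define s where "s R = sign_prob 0 (kv i R)" for R
    have s: "s R \<le> 1" "s R \<ge> 0" for R
    proof -
      have "card {xs \<in> signs (length (kv i R)). 0 dvd dot xs (kv i R)} \<le> card (signs (length (kv i R)))"
        by (intro card_mono) auto
      then have "real (card {xs \<in> signs (length (kv i R)). 0 dvd dot xs (kv i R)}) \<le> real (2 ^ length (kv i R))"
        unfolding of_nat_le_iff by simp
      then show "s R \<le> 1" by (simp add: s_def sign_prob_def)
      show "s R \<ge> 0" by (simp add: s_def sign_prob_nonneg)
    qed
    have cP: "real (card P) = 2 ^ (n * (n - 1))"
      using cI i by (simp add: P_def card_PiE power_mult)
    have "real (card (W i)) = (\<Sum>R\<in>P. real (card {x \<in> signs n. dot x (kv i R) = 0}))"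
      unfolding W_def P_def of_nat_sum[symmetric] using finP by (subst card_SigmaI) auto
    also have "\<dots> = (\<Sum>R\<in>P. 2 ^ n * s R)"
    proof (rule sum.cong)
      fix R assume "R \<in> P"
      then have "length (kv i R) = n" using kv[OF i] by (simp add: P_def)
      from card_signs_dvd[OF this, of 0]
      show "real (card {x \<in> signs n. dot x (kv i R) = 0}) = 2 ^ n * s R" by (simp add: s_def)
    qed simp
    also have "\<dots> = 2 ^ n * (\<Sum>R\<in>P. s R)" by (simp add: sum_distrib_left)
    \<comment> \<open>Exceptional choices of the other rows are charged the trivial probability 1,
      all others at most \<open>t\<close>.\<close>
    also have "(\<Sum>R\<in>P. s R) \<le> (\<Sum>R\<in>P. t + (if s R > t then 1 else 0))"
      using s t by (intro sum_mono) (auto intro: order_trans[OF s(1)])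
    also have "\<dots> = real (card P) * t + real (card {R \<in> P. s R > t})"
      using finP[of i] by (simp add: sum.distrib sum.If_cases P_def Int_def)
    also have "real (card {R \<in> P. s R > t}) \<le> (\<Sum>(p, w)\<in>T. real (card (I i \<rightarrow>\<^sub>E {x \<in> signs n. p dvd dot x w})))"
    proof -
      have "{R \<in> P. s R > t} \<subseteq> (\<Union>(p, w)\<in>T. I i \<rightarrow>\<^sub>E {x \<in> signs n. p dvd dot x w})"
      proof
        fix R assume "R \<in> {R \<in> P. s R > t}"
        then have R: "R \<in> I i \<rightarrow>\<^sub>E signs n" "sign_prob 0 (kv i R) > t" by (auto simp: P_def s_def)
        have k: "length (kv i R) = n" "\<exists>x\<in>set (kv i R). x \<noteq> 0" "\<forall>x\<in>set (kv i R). \<bar>x\<bar> \<le> (2 * int n + 1) ^ n"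
          "\<forall>j\<in>I i. dot (R j) (kv i R) = 0" using kv[OF i R(1)] by auto
        obtain p where p: "(p, map (\<lambda>x. x mod p) (kv i R)) \<in> T" using cover[OF k(1-3) R(2)] by blast
        have "R \<in> I i \<rightarrow>\<^sub>E {x \<in> signs n. p dvd dot x (map (\<lambda>x. x mod p) (kv i R))}"
          using R(1) k(4) by (auto simp: PiE_iff dvd_dot_mod)
        then show "R \<in> (\<Union>(p, w)\<in>T. I i \<rightarrow>\<^sub>E {x \<in> signs n. p dvd dot x w})" using p by blast
      qed
      then have "card {R \<in> P. s R > t} \<le> card (\<Union>(p, w)\<in>T. I i \<rightarrow>\<^sub>E {x \<in> signs n. p dvd dot x w})"
        using T(1) cI by (intro card_mono finite_UN_I) (auto intro!: finite_PiE)
      also have "\<dots> = card (\<Union>z\<in>T. I i \<rightarrow>\<^sub>E {x \<in> signs n. fst z dvd dot x (snd z)})"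
        by (simp add: case_prod_beta)
      also have "\<dots> \<le> (\<Sum>z\<in>T. card (I i \<rightarrow>\<^sub>E {x \<in> signs n. fst z dvd dot x (snd z)}))"
        by (rule card_UN_le[OF T(1)])
      finally show ?thesis
        unfolding case_prod_beta of_nat_sum[symmetric] of_nat_le_iff .
    qed
    also have "(\<Sum>(p, w)\<in>T. real (card (I i \<rightarrow>\<^sub>E {x \<in> signs n. p dvd dot x w}))) =
       2 ^ (n * (n - 1)) * (\<Sum>(p, w)\<in>T. sign_prob p w ^ (n - 1))"
      unfolding sum_distrib_left
    proof (rule sum.cong, simp, clarify)
      fix p w assume "(p, w) \<in> T"
      then have "length w = n" by (rule T(2))
      then show "real (card (I i \<rightarrow>\<^sub>E {x \<in> signs n. p dvd dot x w})) = 2 ^ (n * (n - 1)) * sign_prob p w ^ (n - 1)"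
        using cI i by (simp add: card_PiE card_signs_dvd power_mult power_mult_distrib)
    qed
    finally have "real (card (W i)) \<le> 2 ^ n * (2 ^ (n * (n - 1)) * t + 2 ^ (n * (n - 1)) * (\<Sum>(p, w)\<in>T. sign_prob p w ^ (n - 1)))"
      by (simp add: cP)
    also have "\<dots> = 2 ^ (n + n * (n - 1)) * (t + (\<Sum>(p, w)\<in>T. sign_prob p w ^ (n - 1)))"
      by (simp add: power_add distrib_left mult_ac)
    also have "n + n * (n - 1) = n * n" using n by (cases n) auto
    finally show "real (card (W i)) \<le> 2 ^ (n * n) * (t + (\<Sum>(p, w)\<in>T. sign_prob p w ^ (n - 1)))" .
  qed
  also have "\<dots> = 2 ^ (n * n) * (real n * (t + (\<Sum>(p, w)\<in>T. sign_prob p w ^ (n - 1))))" by simp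
  finally show ?thesis by (simp add: Z_def)
qed

text \<open>Outside a null event the entries are signs, and independence gives each of the
  \<open>2 ^ (n * n)\<close> sign matrices the same probability. Singularity then becomes a
  dependence among the rows.\<close>

lemma measure_det_zero_le:
  assumes rsm: "random_sign_matrix \<Omega> n M" and n: "n \<ge> 1"
  shows "measure \<Omega> {\<omega> \<in> space \<Omega>. Determinant.det (M \<omega>) = 0} \<le>
           real (card {R \<in> {..<n} \<rightarrow>\<^sub>E signs n. dependent_rows n R}) / 2 ^ (n * n)"
proof -
  interpret prob_space \<Omega> using rsm by (simp add: random_sign_matrix_def)
  define I where "I = {0..<n} \<times> {0..<n}"
  have I: "finite I" "I \<noteq> {}" using n by (auto simp: I_def)
  have carr: "\<And>\<omega>. \<omega> \<in> space \<Omega> \<Longrightarrow> M \<omega> \<in> carrier_mat n n"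
    and ind: "indep_vars (\<lambda>_. borel) (\<lambda>ij \<omega>. M \<omega> $$ ij) I"
    and half: "\<And>i j. i < n \<Longrightarrow> j < n \<Longrightarrow> prob {\<omega> \<in> space \<Omega>. M \<omega> $$ (i, j) = 1} = 1 / 2"
      "\<And>i j. i < n \<Longrightarrow> j < n \<Longrightarrow> prob {\<omega> \<in> space \<Omega>. M \<omega> $$ (i, j) = - 1} = 1 / 2"
    using rsm by (auto simp: random_sign_matrix_def I_def)
  have meas [measurable]: "(\<lambda>\<omega>. M \<omega> $$ ij) \<in> borel_measurable \<Omega>" if "ij \<in> I" for ij
    using ind that by (auto simp: indep_vars_def2)
  define Z where "Z = {R \<in> {..<n} \<rightarrow>\<^sub>E signs n. dependent_rows n R}"
  have finZ: "finite Z" unfolding Z_def by (rule finite_subset[of _ "{..<n} \<rightarrow>\<^sub>E signs n"]) (auto intro!: finite_PiE)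
  define E where "E R = (\<Inter>ij\<in>I. (\<lambda>\<omega>. M \<omega> $$ ij) -` {real_of_int (R (fst ij) ! snd ij)} \<inter> space \<Omega>)" for R :: "nat \<Rightarrow> int list"
  have E_sets: "E R \<in> sets \<Omega>" for R
    unfolding E_def using I meas by (intro sets.finite_INT) (auto intro!: measurable_sets)
  have prob_E: "prob (E R) = 1 / 2 ^ (n * n)" if R: "R \<in> {..<n} \<rightarrow>\<^sub>E signs n" for R
  proof -
    have "prob (E R) = (\<Prod>ij\<in>I. prob ((\<lambda>\<omega>. M \<omega> $$ ij) -` {real_of_int (R (fst ij) ! snd ij)} \<inter> space \<Omega>))"
      unfolding E_def by (rule indep_varsD_finite[OF ind]) (use I in auto)
    also have "\<dots> = (\<Prod>ij\<in>I. 1 / 2)"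
    proof (rule prod.cong)
      fix ij assume ij: "ij \<in> I"
      then obtain i j where [simp]: "ij = (i, j)" and lt: "i < n" "j < n" by (auto simp: I_def)
      have "R i \<in> signs n" using R lt by auto
      then have "R i ! j \<in> set (R i)" "set (R i) \<subseteq> {-1, 1}" using lt by (auto simp: signs_def)
      then consider "R i ! j = 1" | "R i ! j = - 1" by blast
      then show "prob ((\<lambda>\<omega>. M \<omega> $$ ij) -` {real_of_int (R (fst ij) ! snd ij)} \<inter> space \<Omega>) = 1 / 2"
      proof cases
        case 1
        then have "(\<lambda>\<omega>. M \<omega> $$ ij) -` {real_of_int (R (fst ij) ! snd ij)} \<inter> space \<Omega> = {\<omega> \<in> space \<Omega>. M \<omega> $$ (i, j) = 1}" by auto
        then show ?thesis using half(1)[OF lt] by simp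
      next
        case 2
        then have "(\<lambda>\<omega>. M \<omega> $$ ij) -` {real_of_int (R (fst ij) ! snd ij)} \<inter> space \<Omega> = {\<omega> \<in> space \<Omega>. M \<omega> $$ (i, j) = - 1}" by auto
        then show ?thesis using half(2)[OF lt] by simp
      qed
    qed simp
    also have "\<dots> = 1 / 2 ^ (n * n)" by (simp add: I_def power_one_over)
    finally show ?thesis .
  qed
  define F where "F ij = {\<omega> \<in> space \<Omega>. M \<omega> $$ ij \<noteq> 1 \<and> M \<omega> $$ ij \<noteq> - 1}" for ij
  have F_sets: "F ij \<in> sets \<Omega>" if "ij \<in> I" for ij
    unfolding F_def using meas[OF that] by measurable
  have prob_F: "prob (F ij) = 0" if ij: "ij \<in> I" for ij
  proof -
    obtain i j where [simp]: "ij = (i, j)" and lt: "i < n" "j < n" using ij by (auto simp: I_def)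
    note m = meas[OF ij, simplified]
    let ?A = "{\<omega> \<in> space \<Omega>. M \<omega> $$ (i, j) = 1}" and ?B = "{\<omega> \<in> space \<Omega>. M \<omega> $$ (i, j) = - 1}"
    have AB: "?A \<in> sets \<Omega>" "?B \<in> sets \<Omega>" using m by measurable
    have "prob (?A \<union> ?B) = prob ?A + prob ?B" using AB by (intro finite_measure_Union) auto
    then have "prob (?A \<union> ?B) = 1" using half[OF lt] by simp
    moreover have "F ij = space \<Omega> - (?A \<union> ?B)" by (auto simp: F_def)
    ultimately show ?thesis using AB by (simp add: prob_compl)
  qed
  have "{\<omega> \<in> space \<Omega>. Determinant.det (M \<omega>) = 0} \<subseteq> (\<Union>R\<in>Z. E R) \<union> (\<Union>ij\<in>I. F ij)"
  proof
    fix \<omega> assume "\<omega> \<in> {\<omega> \<in> space \<Omega>. Determinant.det (M \<omega>) = 0}"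
    then have \<omega>: "\<omega> \<in> space \<Omega>" "Determinant.det (M \<omega>) = 0" by auto
    define A where "A = M \<omega>"
    have A: "A \<in> carrier_mat n n" using carr \<omega> by (simp add: A_def)
    show "\<omega> \<in> (\<Union>R\<in>Z. E R) \<union> (\<Union>ij\<in>I. F ij)"
    proof (cases "\<omega> \<in> (\<Union>ij\<in>I. F ij)")
      case False
      then have pm: "A $$ (i, j) = 1 \<or> A $$ (i, j) = - 1" if "i < n" "j < n" for i j
        using that \<omega> by (auto simp: F_def I_def A_def)
      define R where "R = restrict (\<lambda>i. map (\<lambda>j. if A $$ (i, j) = 1 then 1 else - 1 :: int) [0..<n]) {..<n}"
      have R_nth: "real_of_int (R i ! j) = A $$ (i, j)" if "i < n" "j < n" for i j
        using pm[OF that] that by (auto simp: R_def)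
      have "R i \<in> signs n" if i: "i < n" for i
        using i by (auto simp: R_def signs_def)
      then have RP: "R \<in> {..<n} \<rightarrow>\<^sub>E signs n" by (auto simp: R_def)
      \<comment> \<open>A kernel vector of the transpose lists the coefficients of a relation among
        the rows.\<close>
      have "det (transpose_mat A) = 0" using \<omega> A by (simp add: det_transpose A_def)
      then obtain c where c: "c \<in> carrier_vec n" "c \<noteq> 0\<^sub>v n" "transpose_mat A *\<^sub>v c = 0\<^sub>v n"
        using det_0_iff_vec_prod_zero[of "transpose_mat A" n] A by auto
      have "\<exists>i<n. c $ i \<noteq> 0"
      proof (rule ccontr)
        assume "\<not> (\<exists>i<n. c $ i \<noteq> 0)"
        then have "c = 0\<^sub>v n" using c(1) by (intro eq_vecI) auto
        then show False using c(2) by simp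
      qed
      moreover have "(\<Sum>i<n. c $ i * real_of_int (R i ! k)) = 0" if k: "k < n" for k
      proof -
        have "0 = (transpose_mat A *\<^sub>v c) $ k" using c(3) k by simp
        also have "\<dots> = (\<Sum>i<n. A $$ (i, k) * c $ i)"
          using A c(1) k by (simp add: scalar_prod_def lessThan_atLeast0)
        also have "\<dots> = (\<Sum>i<n. c $ i * real_of_int (R i ! k))"
          using R_nth k by (intro sum.cong) auto
        finally show ?thesis by simp
      qed
      ultimately have "dependent_rows n R" unfolding dependent_rows_def by (intro exI[of _ "\<lambda>i. c $ i"]) auto
      then have "R \<in> Z" using RP by (simp add: Z_def)
      moreover have "\<omega> \<in> E R" using \<omega> R_nth by (auto simp: E_def I_def A_def)
      ultimately show ?thesis by blast
    qed simp
  qed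
  then have "prob {\<omega> \<in> space \<Omega>. Determinant.det (M \<omega>) = 0} \<le> prob ((\<Union>R\<in>Z. E R) \<union> (\<Union>ij\<in>I. F ij))"
    using E_sets F_sets finZ I by (intro finite_measure_mono sets.Un sets.finite_UN) auto
  also have "\<dots> \<le> prob (\<Union>R\<in>Z. E R) + prob (\<Union>ij\<in>I. F ij)"
    using E_sets F_sets finZ I by (intro measure_Un_le sets.finite_UN) auto
  also have "prob (\<Union>R\<in>Z. E R) \<le> (\<Sum>R\<in>Z. prob (E R))"
    using E_sets finZ by (intro finite_measure_subadditive_finite) auto
  also have "(\<Sum>R\<in>Z. prob (E R)) = real (card Z) / 2 ^ (n * n)"
    using prob_E by (simp add: Z_def)
  also have "prob (\<Union>ij\<in>I. F ij) \<le> (\<Sum>ij\<in>I. prob (F ij))"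
    using F_sets I by (intro finite_measure_subadditive_finite) auto
  also have "(\<Sum>ij\<in>I. prob (F ij)) = 0" using prob_F by simp
  finally show ?thesis by (simp add: Z_def)
qed

section \<open>The union bound\<close>

text \<open>From \<open>1 - y \<le> exp (- y)\<close> by taking logarithms; this turns decay of the
  return probability into a bound on the number of bad steps.\<close>

lemma power_decay_bound:
  fixes x K \<eta> :: real
  assumes "0 < x" "0 < K" "0 < \<eta>" "\<eta> \<le> 1" "x \<le> K * (1 - \<eta> / 4) ^ c"
  shows "real c \<le> 4 / \<eta> * ln (K / x)"
proof -
  have "(1 - \<eta> / 4) ^ c \<le> exp (- (\<eta> / 4)) ^ c"
    using assms exp_ge_add_one_self[of "- (\<eta> / 4)"] by (intro power_mono) auto
  also have "\<dots> = exp (- (real c * \<eta> / 4))" by (simp flip: exp_of_nat_mult)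
  finally have "x \<le> K * exp (- (real c * \<eta> / 4))"
    using assms by (meson mult_left_mono less_imp_le order_trans)
  then have "ln x \<le> ln (K * exp (- (real c * \<eta> / 4)))"
    using assms by (subst ln_le_cancel_iff) auto
  then have "ln x \<le> ln K - real c * \<eta> / 4" using assms by (simp add: ln_mult)
  then have "real c * \<eta> \<le> 4 * ln (K / x)" using assms by (simp add: ln_div)
  then show ?thesis using assms by (simp add: field_simps)
qed

text \<open>With \<open>\<Theta> = 2\<close> no value reaches the threshold, and at concentration
  \<open>2 / (m + 1)\<close> the bound for good residues becomes \<open>b = 1\<close>. So all but
  \<open>e\<close> coordinates are determined by the earlier ones; \<open>\<kappa> = 1 / 10\<close>
  keeps the exponential factor small.\<close>

lemma card_strongly_concentrated:
  assumes p: "prime p" "odd p" "m + 1 < p"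
    and e: "8 * real (3 * m + 1) ^ 2 * ln (real (m + 1)) \<le> real e"
  shows "real (card {ws. length ws = n \<and> set ws \<subseteq> {0..<int p} \<and> sign_prob (int p) ws \<ge> 2 / real (m + 1)})
     \<le> (11 / 10) ^ n * (10 * real p) ^ e"
proof -
  define \<eta> where "\<eta> = 1 / (2 * real (3 * m + 1) ^ 2)"
  have \<eta>: "0 < \<eta>" "real (3 * m + 1) ^ 2 * \<eta> \<le> 1 / 2" by (auto simp: \<eta>_def)
  have "1 * \<eta> \<le> real (3 * m + 1) ^ 2 * \<eta>" using \<eta>(1) by (intro mult_right_mono one_le_power) auto
  then have \<eta>1: "\<eta> \<le> 1" using \<eta>(2) by linarith
  have "real (card {ws. length ws = n \<and> set ws \<subseteq> {0..<int p} \<and> sign_prob (int p) ws \<ge> 2 / real (m + 1)})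
     \<le> (1 + 1 / 10) ^ n * (real p / (1 / 10)) ^ e * 1 ^ (n - e)"
  proof (rule card_concentrated[where \<Theta> = 2 and \<eta> = \<eta> and m = m])
    show "2 / (2 / real (m + 1)) < real p" using p(3) by simp
    fix a c
    assume "a = 0 \<or> (2::real) \<le> 1 \<and> 2 / real (m + 1) \<le> (61 / 80) ^ a"
      and c: "c = 0 \<or> 2 / real (m + 1) \<le> 2 * (1 - \<eta> / 4) ^ c"
    then have a: "a = 0" by simp
    have "real c \<le> real e"
    proof (cases "c = 0")
      case False
      then have "2 / real (m + 1) \<le> 2 * (1 - \<eta> / 4) ^ c" using c by blast
      then have "real c \<le> 4 / \<eta> * ln (2 / (2 / real (m + 1)))"
        using \<eta> \<eta>1 by (intro power_decay_bound) auto
      also have "4 / \<eta> = 8 * real (3 * m + 1) ^ 2" by (simp add: \<eta>_def)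
      also have "2 / (2 / real (m + 1)) = real (m + 1)" by simp
      also note e
      finally show ?thesis .
    qed simp
    then show "a + c \<le> e" using a by simp
  qed (use p \<eta> in auto)
  then show ?thesis by (simp add: mult.commute)
qed

text \<open>Together these turn \<open>(15 / 16) ^ n / 16 \<le> (61 / 80) ^ a\<close> into
  \<open>a \<le> 6 * n / 25 + 11\<close>, eventually below \<open>n / 4\<close>.\<close>

lemma ln_ratio_bounds:
  "25 * ln (16 / 15 :: real) \<le> 6 * ln (80 / 61)" "ln (16 :: real) \<le> 11 * ln (80 / 61)"
proof -
  have "ln ((16 / 15 :: real) ^ 25) \<le> ln ((80 / 61) ^ 6)"
    by (subst ln_le_cancel_iff) (simp_all add: power_divide divide_simps)
  then show "25 * ln (16 / 15 :: real) \<le> 6 * ln (80 / 61)" by (simp add: ln_realpow)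
  have "ln (16 :: real) \<le> ln ((80 / 61) ^ 11)"
    by (subst ln_le_cancel_iff) (simp_all add: power_divide divide_simps)
  then show "ln (16 :: real) \<le> 11 * ln (80 / 61)" by (simp add: ln_realpow)
qed

text \<open>The threshold is \<open>n\<close> times the concentration level. Then below it only
  about \<open>ln n / \<eta>\<close> bad steps fit, and above it Markov's bound is already strong
  enough because \<open>10 * (m + 1) \<le> n\<close>. The bad steps above it use most of the budget:
  each costs a factor \<open>61 / 80\<close>.\<close>

lemma card_weakly_concentrated:
  fixes \<mu> :: real
  assumes p: "prime p" "odd p" and \<mu>: "\<mu> > 16"
    and m: "10 * (m + 1) \<le> n" and \<alpha>: "\<mu> / (8 * real p) \<le> 2 / real (m + 1)" "(15 / 16) ^ n / 16 \<le> \<mu> / (8 * real p)"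
    and e: "6 * real n / 25 + 11 + 8 * real (3 * m + 1) ^ 2 * ln (real n) \<le> real e"
  shows "real (card {ws. length ws = n \<and> set ws \<subseteq> {0..<int p} \<and> sign_prob (int p) ws \<ge> \<mu> / (8 * real p)})
     \<le> 2 ^ n * real p ^ e * (16 * real p / (real (m + 1) * \<mu>)) ^ (n - e)"
proof -
  define \<eta> where "\<eta> = 1 / (2 * real (3 * m + 1) ^ 2)"
  have \<eta>: "0 < \<eta>" "real (3 * m + 1) ^ 2 * \<eta> \<le> 1 / 2" by (auto simp: \<eta>_def)
  have "1 * \<eta> \<le> real (3 * m + 1) ^ 2 * \<eta>" using \<eta>(1) by (intro mult_right_mono one_le_power) auto
  then have \<eta>1: "\<eta> \<le> 1" using \<eta>(2) by linarith
  have p0: "real p > 0" using p by (simp add: prime_gt_0_nat)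
  have n0: "n > 0" using m by simp
  define A where "A = \<mu> / (8 * real p)"
  have A0: "A > 0" using \<mu> p0 by (simp add: A_def)
  have b_eq: "16 * real p / (real (m + 1) * \<mu>) = 2 / (real (m + 1) * A)"
    using \<mu> p0 by (simp add: A_def field_simps)
  have "real (card {ws. length ws = n \<and> set ws \<subseteq> {0..<int p} \<and> sign_prob (int p) ws \<ge> A})
     \<le> (1 + 1) ^ n * (real p / 1) ^ e * (2 / (real (m + 1) * A)) ^ (n - e)"
  proof (rule card_concentrated[where \<Theta> = "real n * A" and \<eta> = \<eta> and m = m])
    show "2 / A < real p" using \<mu> p0 by (simp add: A_def field_simps)
    show "real n * A > 1 \<or> 20 / (real n * A) \<le> 2 / (real (m + 1) * A)"
    proof (rule disjI2)
      have "real (10 * (m + 1)) \<le> real n" using m by (simp only: of_nat_le_iff)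
      then have "20 * (real (m + 1) * A) \<le> 2 * (real n * A)" using A0 by simp
      then show "20 / (real n * A) \<le> 2 / (real (m + 1) * A)"
        using A0 n0 by (simp add: frac_le_eq divide_le_0_iff)
    qed
    have "A * real (m + 1) \<le> 2" using \<alpha>(1)[folded A_def] by (subst (asm) pos_le_divide_eq) auto
    then show "1 \<le> 2 / (real (m + 1) * A)"
      using A0 by (subst le_divide_eq_1_pos) (auto simp: mult.commute)
    fix a c
    assume a: "a = 0 \<or> real n * A \<le> 1 \<and> A \<le> (61 / 80) ^ a"
      and c: "c = 0 \<or> A \<le> real n * A * (1 - \<eta> / 4) ^ c"
    have "real c \<le> 8 * real (3 * m + 1) ^ 2 * ln (real n)"
    proof (cases "c = 0")
      case False
      then have "A \<le> real n * A * (1 - \<eta> / 4) ^ c" using c by blast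
      then have "real c \<le> 4 / \<eta> * ln (real n * A / A)"
        using \<eta> \<eta>1 A0 n0 by (intro power_decay_bound) auto
      also have "4 / \<eta> = 8 * real (3 * m + 1) ^ 2" by (simp add: \<eta>_def)
      finally show ?thesis using A0 by simp
    qed (use n0 in simp)
    moreover have "real a \<le> 6 * real n / 25 + 11"
    proof (cases "a = 0")
      case False
      then have "(15 / 16) ^ n / 16 \<le> (61 / 80 :: real) ^ a" using a \<alpha>(2) by (simp add: A_def)
      then have "ln ((15 / 16) ^ n / 16) \<le> ln ((61 / 80 :: real) ^ a)"
        by (subst ln_le_cancel_iff) auto
      then have "real n * ln (15 / 16) - ln 16 \<le> real a * ln (61 / 80)"
        by (simp add: ln_div ln_realpow)
      moreover have "ln (15 / 16 :: real) = - ln (16 / 15)" "ln (61 / 80 :: real) = - ln (80 / 61)"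
        by (simp_all add: ln_div)
      ultimately have "real a * ln (80 / 61) \<le> real n * ln (16 / 15) + ln 16" by simp
      also have "\<dots> \<le> real n * (6 / 25 * ln (80 / 61)) + 11 * ln (80 / 61)"
        using ln_ratio_bounds by (intro add_mono mult_left_mono) auto
      also have "\<dots> = (6 * real n / 25 + 11) * ln (80 / 61)" by (simp add: algebra_simps)
      finally show ?thesis by simp
    qed simp
    ultimately have "real (a + c) \<le> real e" using e by simp
    then show "a + c \<le> e" by (simp only: of_nat_le_iff)
  qed (use p \<eta> A0 n0 in auto)
  then show ?thesis unfolding b_eq A_def by simp
qed

text \<open>If the first entry \<open>a\<close> is nonzero, its sign forces the remaining sum to be
  \<open>- a\<close> or \<open>a\<close>, two disjoint events; a zero entry changes nothing.\<close>

lemma sign_prob_le_half: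
  assumes "\<exists>x\<in>set v. x \<noteq> 0"
  shows "sign_prob 0 v \<le> 1 / 2"
  using assms
proof (induction v)
  case (Cons a v)
  define n where "n = length v"
  define P where "P c = {xs \<in> signs n. dot xs v = c}" for c
  have finP: "finite (P c)" for c by (simp add: P_def)
  have "{xs \<in> signs (Suc n). dot xs (a # v) = 0} = (#) 1 ` P (- a) \<union> (#) (- 1) ` P a"
    by (auto simp: signs_Suc P_def)
  then have "card {xs \<in> signs (Suc n). dot xs (a # v) = 0} = card (P (- a)) + card (P a)"
    using finP by (simp only:) (subst card_Un_disjoint, auto simp: card_image)
  then have eq: "sign_prob 0 (a # v) = (real (card (P (- a))) + real (card (P a))) / (2 * 2 ^ n)"
    by (simp add: sign_prob_def n_def)
  show ?case
  proof (cases "a = 0")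
    case True
    then have "sign_prob 0 (a # v) = sign_prob 0 v"
      unfolding eq by (simp add: sign_prob_def n_def P_def)
    then show ?thesis using Cons True by simp
  next
    case False
    then have "card (P (- a)) + card (P a) = card (P (- a) \<union> P a)"
      using finP by (intro card_Un_disjoint[symmetric]) (auto simp: P_def)
    also have "\<dots> \<le> card (signs n)" by (intro card_mono) (auto simp: P_def)
    finally have "real (card (P (- a)) + card (P a)) \<le> real (2 ^ n)"
      unfolding of_nat_le_iff by simp
    then show ?thesis unfolding eq by (simp add: field_simps)
  qed
qed simp

lemma sign_prob_0_le: "sign_prob 0 v \<le> sign_prob p v"
proof -
  have "card {xs \<in> signs (length v). 0 dvd dot xs v} \<le> card {xs \<in> signs (length v). p dvd dot xs v}"
    by (intro card_mono) auto
  then show ?thesis by (simp add: sign_prob_def divide_right_mono)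
qed

section \<open>Covering concentrated vectors by two families of primes\<close>

lemma finite_residue_lists:
  "finite {w. length w = n \<and> set w \<subseteq> {0..<p::int} \<and> P w}"
  by (rule finite_bounded_lists) simp

text \<open>The lower level \<open>L\<close> controls how many residue vectors occur, the upper
  level \<open>U\<close> how much each contributes; \<open>C\<close> bounds the product uniformly
  over the primes.\<close>

lemma sum_prime_levels_le:
  fixes L U :: "nat \<Rightarrow> real" and PS :: "nat set"
  assumes PS: "finite PS" and U: "\<And>p. p \<in> PS \<Longrightarrow> U p \<ge> 0"
    and card: "\<And>p. p \<in> PS \<Longrightarrow> real (card {w. length w = n \<and> set w \<subseteq> {0..<int p} \<and> sign_prob (int p) w \<ge> L p}) * U p ^ k \<le> C"
  defines "T \<equiv> {(int p, w) | p w. p \<in> PS \<and> length w = n \<and> set w \<subseteq> {0..<int p} \<and> L p \<le> sign_prob (int p) w \<and> sign_prob (int p) w \<le> U p}"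
  shows "finite T \<and> (\<Sum>(p, w)\<in>T. sign_prob p w ^ k) \<le> real (card PS) * C"
proof -
  define W where "W p = {w. length w = n \<and> set w \<subseteq> {0..<int p} \<and> (L p \<le> sign_prob (int p) w \<and> sign_prob (int p) w \<le> U p)}" for p
  have finW: "finite (W p)" for p unfolding W_def by (rule finite_residue_lists)
  have T_eq: "T = (\<lambda>(p, w). (int p, w)) ` (SIGMA p : PS. W p)"
    by (force simp: T_def W_def)
  have inj: "inj_on (\<lambda>(p, w). (int p, w)) (SIGMA p : PS. W p)" by (auto simp: inj_on_def)
  have "(\<Sum>(p, w)\<in>T. sign_prob p w ^ k) = (\<Sum>(p, w)\<in>(SIGMA p : PS. W p). sign_prob (int p) w ^ k)"
    unfolding T_eq by (subst sum.reindex[OF inj]) (auto intro!: sum.cong)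
  also have "\<dots> = (\<Sum>p\<in>PS. \<Sum>w\<in>W p. sign_prob (int p) w ^ k)"
    using PS finW by (intro sum.Sigma[symmetric]) auto
  also have "\<dots> \<le> (\<Sum>p\<in>PS. C)"
  proof (rule sum_mono)
    fix p assume p: "p \<in> PS"
    have "(\<Sum>w\<in>W p. sign_prob (int p) w ^ k) \<le> (\<Sum>w\<in>W p. U p ^ k)"
      by (intro sum_mono power_mono) (auto simp: W_def sign_prob_nonneg)
    also have "\<dots> = real (card (W p)) * U p ^ k" by simp
    also have "\<dots> \<le> real (card {w. length w = n \<and> set w \<subseteq> {0..<int p} \<and> sign_prob (int p) w \<ge> L p}) * U p ^ k"
      using U[OF p] by (intro mult_right_mono of_nat_mono card_mono finite_residue_lists) (auto simp: W_def)
    also have "\<dots> \<le> C" by (rule card[OF p])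
    finally show "(\<Sum>w\<in>W p. sign_prob (int p) w ^ k) \<le> C" .
  qed
  finally have "(\<Sum>(p, w)\<in>T. sign_prob p w ^ k) \<le> real (card PS) * C" by simp
  moreover have "finite T" unfolding T_eq using PS finW by auto
  ultimately show ?thesis by blast
qed

text \<open>For concentration at least \<open>2 / (m + 1)\<close>, primes of order
  \<open>n\<^sup>2\<close> suffice: the error is at most \<open>1 / 10\<close> on top of the trivial
  \<open>1 / 2\<close>. Below that, the window is scaled to \<open>\<mu> / sign_prob 0 v\<close>, so
  that the error is comparable to the concentration itself.\<close>

lemma cover_by_primes:
  fixes \<mu> :: real and v :: "int list"
  defines "n \<equiv> length v"
  assumes n: "n \<ge> 16" and v: "\<exists>x\<in>set v. x \<noteq> 0" "\<forall>x\<in>set v. \<bar>x\<bar> \<le> (2 * int n + 1) ^ n"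
    and \<rho>: "sign_prob 0 v > t" and t: "t > 0"
    and Nmin: "\<And>N. N \<ge> Nmin \<Longrightarrow> real N / 10 \<le> (\<Sum>p | prime p \<and> N < 8 * p \<and> p \<le> N. ln (real p))"
    and \<mu>: "\<mu> \<ge> 32" "\<mu> \<ge> real Nmin" "10 * (ln (real n) + real n * ln (2 * real n + 1)) \<le> \<mu>"
    and n2: "n ^ 2 \<ge> Nmin" "10 * (ln (real n) + real n * ln (2 * real n + 1)) / real n ^ 2 \<le> 1 / 10"
  shows "\<exists>p. prime p \<and> odd p \<and>
     (n ^ 2 < 8 * p \<and> p \<le> n ^ 2 \<and> 2 / real (m + 1) \<le> sign_prob (int p) v \<and> sign_prob (int p) v \<le> 3 / 5 \<or>
      \<mu> / (8 * real p) \<le> 2 / real (m + 1) \<and> real p \<le> 2 * \<mu> / t \<and> \<mu> / (8 * real p) \<le> sign_prob (int p) v \<and> sign_prob (int p) v \<le> 3 * \<mu> / real p)"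
proof -
  define B where "B = real n * (2 * real n + 1) ^ n"
  have "1 * 1 \<le> real n * (2 * real n + 1) ^ n"
    using n by (intro mult_mono one_le_power) auto
  then have B1: "B \<ge> 1" by (simp add: B_def)
  have lnB: "ln B = ln (real n) + real n * ln (2 * real n + 1)"
    using n by (simp add: B_def ln_mult ln_realpow)
  have dotB: "\<bar>real_of_int (dot xs v)\<bar> \<le> B" if "xs \<in> signs (length v)" for xs
  proof -
    have "\<bar>dot xs v\<bar> \<le> int (length v) * (2 * int n + 1) ^ n"
      using that v by (intro abs_dot_signs_le) auto
    then have "real_of_int \<bar>dot xs v\<bar> \<le> real_of_int (int (length v) * (2 * int n + 1) ^ n)"
      by (simp only: of_int_le_iff)
    then show ?thesis by (simp add: B_def n_def)
  qed
  define r where "r = sign_prob 0 v"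
  have r: "r > t" "r \<le> 1 / 2" using \<rho> sign_prob_le_half[OF v(1)] by (auto simp: r_def)
  have r0: "r > 0" using r t by simp
  have ge: "r \<le> sign_prob (int p) v" for p unfolding r_def by (rule sign_prob_0_le)
  show ?thesis
  proof (cases "r \<ge> 2 / real (m + 1)")
    case True
    obtain p where p: "prime p" "n ^ 2 < 8 * p" "p \<le> n ^ 2" "sign_prob (int p) v \<le> r + 10 * ln B / real (n ^ 2)"
      using exists_good_prime[OF B1 dotB, of "n ^ 2"] Nmin[OF n2(1)] n unfolding r_def by auto
    have "16 ^ 2 \<le> n ^ 2" using n by (intro power_mono) auto
    then have "p > 2" using p by simp
    then have "odd p" using p(1) prime_odd_nat by blast
    moreover have "10 * ln B / real (n ^ 2) \<le> 1 / 10" using n2(2) by (simp only: lnB of_nat_power)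
    then have "sign_prob (int p) v \<le> 3 / 5" using p(4) r by linarith
    ultimately show ?thesis using p True ge[of p] by (intro exI[of _ p]) auto
  next
    case False
    \<comment> \<open>Since \<open>10 * ln B \<le> \<mu>\<close>, this size keeps the error at most
      \<open>\<mu> / p\<close>, while every prime of the window satisfies
      \<open>\<mu> / (8 * p) < r \<le> 2 * \<mu> / p\<close>.\<close>
    define N where "N = nat \<lceil>\<mu> / r\<rceil>"
    have "\<mu> * 1 \<le> \<mu> * (1 / r)" using \<mu> r r0 by (intro mult_left_mono) (auto simp: field_simps)
    then have mr: "\<mu> \<le> \<mu> / r" by simp
    have N1: "\<mu> / r \<le> real N" unfolding N_def by (rule real_nat_ceiling_ge)
    have "real N \<le> \<mu> / r + 1" unfolding N_def using \<mu> r0 by (simp add: of_nat_nat)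
    also have "\<dots> \<le> 2 * (\<mu> / r)" using mr \<mu> by linarith
    finally have N2: "real N \<le> 2 * (\<mu> / r)" .
    have N3: "N \<ge> Nmin" "N > 16" using N1 mr \<mu> by linarith+
    obtain p where p: "prime p" "N < 8 * p" "p \<le> N" "sign_prob (int p) v \<le> r + 10 * ln B / real N"
      using exists_good_prime[OF B1 dotB, of N] Nmin[OF N3(1)] N3(2) unfolding r_def by auto
    have "p > 2" using p N3 by simp
    then have odd: "odd p" using p(1) prime_odd_nat by blast
    have p0: "real p > 0" using \<open>p > 2\<close> by simp
    have "\<mu> / r < 8 * real p" using N1 p(2) by linarith
    then have low: "\<mu> / (8 * real p) < r" using r0 p0 by (simp add: field_simps)
    have pN: "real p \<le> real N" using p by simp
    have "real p \<le> 2 * (\<mu> / r)" using pN N2 by linarith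
    then have up: "r \<le> 2 * \<mu> / real p" using r0 p0 by (simp add: field_simps)
    have "10 * ln B / real N \<le> \<mu> / real p"
      using \<mu> pN p0 B1 unfolding lnB[symmetric] by (intro frac_le) auto
    then have "sign_prob (int p) v \<le> 2 * \<mu> / real p + \<mu> / real p" using p(4) up by linarith
    also have "\<dots> = 3 * \<mu> / real p" by (simp add: field_simps)
    finally have c1: "sign_prob (int p) v \<le> 3 * \<mu> / real p" .
    have "2 * (\<mu> / r) \<le> 2 * (\<mu> / t)" using r t \<mu> by (intro mult_left_mono frac_le) auto
    then have "real p \<le> 2 * \<mu> / t" using \<open>real p \<le> 2 * (\<mu> / r)\<close> by simp
    then show ?thesis using p(1) odd low False c1 ge[of p] by (intro exI[of _ p]) auto
  qed
qed

text \<open>The product \<open>11 / 10 * (3 / 5)\<close> is smaller than \<open>15 / 16\<close> by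
  the factor \<open>125 / 88\<close>, which exceeds \<open>exp (1 / 4)\<close>; this slack absorbs
  the polynomial factors and the cost of \<open>e\<close> free coordinates.\<close>

lemma strong_level_total_le:
  fixes n e :: nat
  assumes n: "n \<ge> 1" and e: "2 * ln (real n) + real e * ln (10 * real n ^ 2) + 1 \<le> real n / 4"
  shows "real n ^ 2 * ((11 / 10) ^ n * (10 * real n ^ 2) ^ e * (3 / 5) ^ (n - 1)) \<le> (15 / 16) ^ n"
proof -
  have "exp (1 / 4 :: real) \<le> 1 + 1 / 4 + (1 / 4)\<^sup>2" by (rule exp_bound) auto
  also have "\<dots> \<le> 125 / 88" by (simp add: power2_eq_square)
  finally have "exp (1 / 4 :: real) ^ n \<le> (125 / 88) ^ n" by (intro power_mono) auto
  then have exp_n: "exp (real n / 4) \<le> (125 / 88 :: real) ^ n" by (simp flip: exp_of_nat_mult)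
  have "5 / 3 * real n ^ 2 * (10 * real n ^ 2) ^ e \<le> exp 1 * exp (2 * ln (real n)) * exp (real e * ln (10 * real n ^ 2))"
  proof (intro mult_mono)
    show "5 / 3 \<le> exp (1 :: real)" using exp_ge_add_one_self[of 1] by linarith
    show "real n ^ 2 \<le> exp (2 * ln (real n))" using n by (simp add: exp_double)
    show "(10 * real n ^ 2) ^ e \<le> exp (real e * ln (10 * real n ^ 2))" using n by (simp add: exp_of_nat_mult)
  qed auto
  also have "\<dots> = exp (2 * ln (real n) + real e * ln (10 * real n ^ 2) + 1)" by (simp add: exp_add)
  also have "\<dots> \<le> exp (real n / 4)" using e by simp
  also note exp_n
  finally have main: "5 / 3 * real n ^ 2 * (10 * real n ^ 2) ^ e \<le> (125 / 88) ^ n" .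
  have "(3 / 5 :: real) ^ (n - 1) = 5 / 3 * (3 / 5) ^ n" using n by (cases n) auto
  then have "real n ^ 2 * ((11 / 10) ^ n * (10 * real n ^ 2) ^ e * (3 / 5) ^ (n - 1)) =
     (5 / 3 * real n ^ 2 * (10 * real n ^ 2) ^ e) * ((11 / 10) ^ n * (3 / 5) ^ n)" by simp
  also have "\<dots> \<le> (125 / 88) ^ n * ((11 / 10) ^ n * (3 / 5) ^ n)"
    using main by (intro mult_right_mono) auto
  also have "\<dots> = (125 / 88 * (11 / 10 * (3 / 5))) ^ n" by (simp only: power_mult_distrib)
  also have "125 / 88 * (11 / 10 * (3 / 5)) = (15 / 16 :: real)" by simp
  finally show ?thesis .
qed

text \<open>The \<open>n\<close> factors \<open>p\<close> of the count cancel against the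
  \<open>n - 1\<close> factors \<open>1 / p\<close>, leaving a single \<open>p\<close>, bounded by
  \<open>2 * \<mu> / t\<close>. The constant 96 collects 2, 16 and 3.\<close>

lemma weak_level_single_le:
  fixes p M \<mu> t :: real
  assumes p: "0 < p" "p \<le> 2 * \<mu> / t" and e: "1 \<le> e" "e < n" and \<mu>: "\<mu> \<ge> 1" and M: "M > 0" and t: "t > 0"
  shows "2 ^ n * p ^ e * (16 * p / (M * \<mu>)) ^ (n - e) * (3 * \<mu> / p) ^ (n - 1) \<le> 2 * \<mu> / t * 96 ^ n * \<mu> ^ e / M ^ (n - e)"
proof -
  define k where "k = n - e"
  obtain e' where e': "e = Suc e'" using e by (cases e) auto
  have n1: "n - 1 = e' + k" "n = e + k" using e e' by (auto simp: k_def)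
  have "p ^ e * (16 * p / (M * \<mu>)) ^ k * (3 * \<mu> / p) ^ (e' + k) =
     p * (p * (3 * \<mu> / p)) ^ e' * (16 * p / (M * \<mu>) * (3 * \<mu> / p)) ^ k"
    unfolding e' power_add power_mult_distrib by simp
  also have "p * (3 * \<mu> / p) = 3 * \<mu>" using p by simp
  also have "16 * p / (M * \<mu>) * (3 * \<mu> / p) = 48 / M" using p \<mu> by simp
  also have "p * (3 * \<mu>) ^ e' * (48 / M) ^ k \<le> (2 * \<mu> / t) * (48 ^ e * \<mu> ^ e) * (48 / M) ^ k"
  proof (intro mult_right_mono mult_mono)
    have "(3 * \<mu>) ^ e' \<le> (48 * \<mu>) ^ e'" using \<mu> by (intro power_mono) auto
    also have "\<dots> \<le> (48 * \<mu>) ^ e" using \<mu> e' by (intro power_increasing) auto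
    finally show "(3 * \<mu>) ^ e' \<le> 48 ^ e * \<mu> ^ e" by (simp add: power_mult_distrib)
  qed (use p \<mu> M t in auto)
  also have "\<dots> = 2 * \<mu> / t * 48 ^ n * \<mu> ^ e / M ^ k"
    by (simp add: n1(2) power_add power_divide)
  finally have "2 ^ n * (p ^ e * (16 * p / (M * \<mu>)) ^ k * (3 * \<mu> / p) ^ (e' + k)) \<le> 2 ^ n * (2 * \<mu> / t * 48 ^ n * \<mu> ^ e / M ^ k)"
    by (intro mult_left_mono) auto
  also have "\<dots> = 2 * \<mu> / t * (2 ^ n * 48 ^ n) * \<mu> ^ e / M ^ k" by simp
  also have "(2 :: real) ^ n * 48 ^ n = 96 ^ n" by (simp flip: power_mult_distrib)
  finally show ?thesis unfolding n1(1) k_def[symmetric] by (simp only: mult.assoc)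
qed

text \<open>On the scale \<open>n * ln n\<close>, the bad steps cost at most
  \<open>6 / 5 * (1 / 4)\<close> and the good ones gain at least \<open>9 / 20 * (3 / 4)\<close>.
  The surplus \<open>3 / 80\<close> beats everything exponential in \<open>n\<close>, including the
  outer factor \<open>2 * \<mu> / t\<close> for the number of primes.\<close>

lemma weak_level_total_le:
  fixes n e :: nat and M :: real
  defines "\<mu> \<equiv> real n powr (6 / 5)" and "t \<equiv> (15 / 16 :: real) ^ n"
  assumes n: "n \<ge> 2" and e: "4 * e \<le> n" and M: "real n powr (9 / 20) \<le> M"
    and asym: "2 + 12 / 5 * ln (real n) + 8 * real n \<le> 3 / 80 * real n * ln (real n)"
  shows "2 * \<mu> / t * (2 * \<mu> / t * 96 ^ n * \<mu> ^ e / M ^ (n - e)) \<le> t"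
proof -
  have n0: "real n > 0" using n by simp
  have lnn: "ln (real n) \<ge> 0" using n by simp
  have \<mu>0: "\<mu> > 0" using n0 by (simp add: \<mu>_def)
  have t0: "t > 0" by (simp add: t_def)
  have M0: "M > 0" using M n0 by (smt (verit) powr_gt_zero)
  have ln\<mu>: "ln \<mu> = 6 / 5 * ln (real n)" using n0 by (simp add: \<mu>_def ln_powr)
  have lnM: "ln M \<ge> 9 / 20 * ln (real n)"
  proof -
    have "ln (real n powr (9 / 20)) \<le> ln M" using M n0 M0 by (subst ln_le_cancel_iff) auto
    then show ?thesis using n0 by (simp add: ln_powr)
  qed
  have "ln (16 / 15 :: real) \<le> 16 / 15 - 1" by (rule ln_le_minus_one) simp
  moreover have "ln (15 / 16 :: real) = - ln (16 / 15)" by (simp add: ln_div)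
  ultimately have l1516: "ln (15 / 16 :: real) \<ge> - 1" by simp
  have lnt: "ln t \<ge> - real n"
  proof -
    have "real n * (- 1) \<le> real n * ln (15 / 16)" using l1516 by (intro mult_left_mono) auto
    then show ?thesis by (simp add: t_def ln_realpow)
  qed
  have "ln (96 :: real) \<le> 5"
  proof -
    have "(96 :: real) \<le> (5 / 2) ^ 5" by (simp add: power_divide)
    also have "\<dots> \<le> exp 1 ^ 5" using exp_ge_add_one_self[of 1] exp_lower_Taylor_quadratic[of 1] by (intro power_mono) auto
    also have "\<dots> = exp 5" by (simp flip: exp_of_nat_mult)
    finally have "ln 96 \<le> ln (exp (5::real))" by (subst ln_le_cancel_iff) auto
    then show ?thesis by simp
  qed
  then have ln96: "real n * ln 96 \<le> 5 * real n" using mult_left_mono[of "ln 96" 5 "real n"] by simp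
  have ln2: "ln (2 :: real) \<le> 1" using ln_le_minus_one[of 2] by simp
  have e4: "real e \<le> real n / 4" using e by simp
  have ne: "real (n - e) = real n - real e" using e by (simp add: of_nat_diff)
  define X where "X = 2 * \<mu> / t * (2 * \<mu> / t * 96 ^ n * \<mu> ^ e / M ^ (n - e))"
  have X0: "X > 0" using \<mu>0 t0 M0 by (simp add: X_def)
  have "ln X = 2 * (ln 2 + ln \<mu> - ln t) + real n * ln 96 + real e * ln \<mu> - real (n - e) * ln M"
    unfolding X_def using \<mu>0 t0 M0 ln_realpow[of 2 2] by (simp add: ln_mult ln_div ln_realpow)
  also have "\<dots> \<le> 2 * (1 + ln \<mu> - ln t) + 5 * real n + real n / 4 * ln \<mu> - (real n - real n / 4) * (9 / 20 * ln (real n))"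
  proof -
    have "real e * ln \<mu> \<le> real n / 4 * ln \<mu>" using e4 lnn by (intro mult_right_mono) (auto simp: ln\<mu>)
    moreover have "(real n - real n / 4) * (9 / 20 * ln (real n)) \<le> real (n - e) * ln M"
      unfolding ne using e4 lnn lnM n0 by (intro mult_mono) auto
    ultimately show ?thesis using ln96 ln2 by (intro diff_mono add_mono) simp_all
  qed
  also have "\<dots> = 2 + 12 / 5 * ln (real n) - 2 * ln t + 5 * real n - 3 / 80 * real n * ln (real n)"
    by (simp add: ln\<mu> algebra_simps)
  \<comment> \<open>The \<open>8 * n\<close> in \<open>asym\<close> is \<open>5 * n\<close> from the
    constant 96 and three times \<open>- ln t \<le> n\<close>.\<close>
  also have "\<dots> \<le> ln t" using asym lnt by linarith
  finally have "X \<le> t" using X0 t0 by simp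
  then show ?thesis by (simp add: X_def)
qed

text \<open>The exponents balance three demands: \<open>9 / 20 < 1 / 2\<close> keeps
  \<open>m\<^sup>2 * ln n\<close> sublinear, \<open>6 / 5 > 1\<close> lets \<open>\<mu>\<close>
  dominate the logarithm of the largest signed sum, and
  \<open>9 / 20 * (3 / 4) > 6 / 5 * (1 / 4)\<close> makes the gain exceed the loss.\<close>

lemma eventually_card_dependent_rows_le:
  "\<forall>\<^sub>F n in sequentially. real (card {R \<in> {..<n} \<rightarrow>\<^sub>E signs n. dependent_rows n R}) \<le>
     2 ^ (n * n) * (3 * real n * (15 / 16) ^ n)"
proof -
  obtain N0 where N0: "\<And>N. N \<ge> N0 \<Longrightarrow> real N / 10 \<le> (\<Sum>p | prime p \<and> N < 8 * p \<and> p \<le> N. ln (real p))"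
    using eventually_many_primes unfolding eventually_sequentially by blast
  let ?x = "\<lambda>n. real n powr (9 / 20)" and ?\<mu> = "\<lambda>n. real n powr (6 / 5)"
  have 1: "\<forall>\<^sub>F n in sequentially. 10 * (?x n + 1) \<le> real n" by real_asymp
  have 2: "\<forall>\<^sub>F n in sequentially. 6 * real n / 25 + 11 + 8 * (3 * ?x n + 1) ^ 2 * ln (real n) \<le> real n / 4 - 1" by real_asymp
  have 3: "\<forall>\<^sub>F n in sequentially. 10 * (ln (real n) + real n * ln (2 * real n + 1)) \<le> ?\<mu> n" by real_asymp
  have 4: "\<forall>\<^sub>F n in sequentially. 10 * (ln (real n) + real n * ln (2 * real n + 1)) / real n ^ 2 \<le> 1 / 10" by real_asymp
  have 5: "\<forall>\<^sub>F n in sequentially. 8 * (?x n + 1) < real n ^ 2" by real_asymp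
  have "filterlim ?\<mu> at_top sequentially" by real_asymp
  then have 6: "\<forall>\<^sub>F n in sequentially. max 32 (real N0) \<le> ?\<mu> n" unfolding filterlim_at_top by blast
  have 7: "\<forall>\<^sub>F n in sequentially. 2 * ln (real n) + (8 * (3 * ?x n + 1) ^ 2 * ln (?x n + 1) + 1) * ln (10 * real n ^ 2) + 1 \<le> real n / 4" by real_asymp
  have 8: "\<forall>\<^sub>F n in sequentially. 2 + 12 / 5 * ln (real n) + 8 * real n \<le> 3 / 80 * real n * ln (real n)" by real_asymp
  show ?thesis
    using 1 2 3 4 5 6 7 8 eventually_ge_at_top[of "max 16 N0"]
  proof eventually_elim
    case (elim n)
    define x \<mu> where "x = real n powr (9 / 20)" and "\<mu> = real n powr (6 / 5)"
    define t where "t = (15 / 16 :: real) ^ n"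
    note E = elim[folded x_def \<mu>_def]
    have n: "n \<ge> 16" "n \<ge> N0" using E(9) by auto
    have t0: "t > 0" by (simp add: t_def)
    have x0: "x \<ge> 0" by (simp add: x_def)
    have \<mu>: "\<mu> \<ge> 32" "\<mu> \<ge> real N0" using E(6) by auto
    have "n \<le> n ^ 2" by (simp add: power2_eq_square)
    then have nn: "n ^ 2 \<ge> N0" using n by linarith
    define m where "m = nat \<lfloor>x\<rfloor>"
    have m: "real m \<le> x" "x \<le> real (m + 1)" using x0 by (auto simp: m_def of_nat_floor) linarith
    have sq: "8 * real (3 * m + 1) ^ 2 \<le> 8 * (3 * x + 1) ^ 2" using m by (intro mult_left_mono power_mono) auto

    define ea where "ea = nat \<lceil>8 * real (3 * m + 1) ^ 2 * ln (real (m + 1))\<rceil>"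
    have ea1: "8 * real (3 * m + 1) ^ 2 * ln (real (m + 1)) \<le> real ea" unfolding ea_def by (rule real_nat_ceiling_ge)
    have "real ea \<le> 8 * real (3 * m + 1) ^ 2 * ln (real (m + 1)) + 1"
    proof -
      have "8 * real (3 * m + 1) ^ 2 * ln (real (m + 1)) \<ge> 0" by simp
      then show ?thesis unfolding ea_def by linarith
    qed
    also have "\<dots> \<le> 8 * (3 * x + 1) ^ 2 * ln (x + 1) + 1"
      using sq m by (intro add_mono mult_mono) auto
    finally have ea2: "real ea \<le> 8 * (3 * x + 1) ^ 2 * ln (x + 1) + 1" .
    define PSa where "PSa = {p. prime p \<and> odd p \<and> n ^ 2 < 8 * p \<and> p \<le> n ^ 2}"
    define Ca where "Ca = (11 / 10) ^ n * (10 * real n ^ 2) ^ ea * (3 / 5 :: real) ^ (n - 1)"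
    have subPSa: "PSa \<subseteq> {1..n ^ 2}" by (auto simp: PSa_def)
    have finPSa: "finite PSa" using subPSa by (rule finite_subset) simp
    define Ta where "Ta = {(int p, w) | p w. p \<in> PSa \<and> length w = n \<and> set w \<subseteq> {0..<int p} \<and>
       2 / real (m + 1) \<le> sign_prob (int p) w \<and> sign_prob (int p) w \<le> 3 / 5}"
    have Ta: "finite Ta \<and> (\<Sum>(p, w)\<in>Ta. sign_prob p w ^ (n - 1)) \<le> real (card PSa) * Ca"
      unfolding Ta_def
    proof (rule sum_prime_levels_le[where U = "\<lambda>_. 3 / 5" and L = "\<lambda>_. 2 / real (m + 1)"])
      fix p assume p: "p \<in> PSa"
      have "8 * real (m + 1) < real n ^ 2" using E(5) m by simp
      then have "8 * (m + 1) < n ^ 2" by (metis of_nat_less_iff of_nat_mult of_nat_numeral of_nat_power)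
      then have "m + 1 < p" using p by (simp add: PSa_def)
      then have "real (card {w. length w = n \<and> set w \<subseteq> {0..<int p} \<and> sign_prob (int p) w \<ge> 2 / real (m + 1)})
        \<le> (11 / 10) ^ n * (10 * real p) ^ ea"
        using p ea1 by (intro card_strongly_concentrated) (auto simp: PSa_def)
      also have "\<dots> \<le> (11 / 10) ^ n * (10 * real n ^ 2) ^ ea"
      proof -
        have "real p \<le> real (n ^ 2)" using p unfolding PSa_def by (simp only: of_nat_le_iff mem_Collect_eq)
        then show ?thesis by (intro mult_left_mono power_mono) auto
      qed
      finally show "real (card {w. length w = n \<and> set w \<subseteq> {0..<int p} \<and> sign_prob (int p) w \<ge> 2 / real (m + 1)}) * (3 / 5) ^ (n - 1) \<le> Ca"
        unfolding Ca_def by (intro mult_right_mono) auto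
    qed (use finPSa in auto)
    have "card PSa \<le> card {1..n ^ 2}" using subPSa by (intro card_mono) auto
    then have "real (card PSa) \<le> real (n ^ 2)" unfolding of_nat_le_iff by simp
    then have "real (card PSa) * Ca \<le> real n ^ 2 * Ca" by (intro mult_right_mono) (auto simp: Ca_def)
    also have "\<dots> \<le> t" unfolding Ca_def t_def
    proof (rule strong_level_total_le)
      have "ln (10 * real n ^ 2) \<ge> 0" using n by (simp add: ln_mult)
      then have "real ea * ln (10 * real n ^ 2) \<le> (8 * (3 * x + 1) ^ 2 * ln (x + 1) + 1) * ln (10 * real n ^ 2)"
        using ea2 by (intro mult_right_mono)
      then show "2 * ln (real n) + real ea * ln (10 * real n ^ 2) + 1 \<le> real n / 4" using E(7) by linarith
    qed (use n in auto)
    finally have sum_a: "(\<Sum>(p, w)\<in>Ta. sign_prob p w ^ (n - 1)) \<le> t" using Ta by linarith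

    \<comment> \<open>As \<open>6 / 25 < 1 / 4\<close>, a quarter of the coordinates leaves room for
      the sublinear number of bad steps below the threshold.\<close>
    define e where "e = n div 4"
    have e: "1 \<le> e" "e < n" "4 * e \<le> n" "real n / 4 - 1 \<le> real e" using n by (auto simp: e_def)
    define PSb where "PSb = {p. prime p \<and> odd p \<and> \<mu> / (8 * real p) \<le> 2 / real (m + 1) \<and> real p \<le> 2 * \<mu> / t}"
    define Cb where "Cb = 2 * \<mu> / t * 96 ^ n * \<mu> ^ e / real (m + 1) ^ (n - e)"
    have subPSb: "PSb \<subseteq> {1..nat \<lfloor>2 * \<mu> / t\<rfloor>}"
      by (auto simp: PSb_def le_nat_floor prime_ge_1_nat[unfolded One_nat_def])
    have finPSb: "finite PSb" using subPSb by (rule finite_subset) simp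
    define Tb where "Tb = {(int p, w) | p w. p \<in> PSb \<and> length w = n \<and> set w \<subseteq> {0..<int p} \<and>
       \<mu> / (8 * real p) \<le> sign_prob (int p) w \<and> sign_prob (int p) w \<le> 3 * \<mu> / real p}"
    have Tb: "finite Tb \<and> (\<Sum>(p, w)\<in>Tb. sign_prob p w ^ (n - 1)) \<le> real (card PSb) * Cb"
      unfolding Tb_def
    proof (rule sum_prime_levels_le[where U = "\<lambda>p. 3 * \<mu> / real p" and L = "\<lambda>p. \<mu> / (8 * real p)"])
      fix p assume p: "p \<in> PSb"
      then have p': "prime p" "odd p" "\<mu> / (8 * real p) \<le> 2 / real (m + 1)" "real p \<le> 2 * \<mu> / t"
        by (auto simp: PSb_def)
      have p0: "real p > 0" using p'(1) by (simp add: prime_gt_0_nat)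
      show "3 * \<mu> / real p \<ge> 0" using \<mu> by simp
      have "real (card {w. length w = n \<and> set w \<subseteq> {0..<int p} \<and> sign_prob (int p) w \<ge> \<mu> / (8 * real p)})
        \<le> 2 ^ n * real p ^ e * (16 * real p / (real (m + 1) * \<mu>)) ^ (n - e)"
      proof (rule card_weakly_concentrated[OF p'(1,2)])
        show "\<mu> > 16" using \<mu> by simp
        have "real (10 * (m + 1)) \<le> real n" using E(1) m by simp
        then show "10 * (m + 1) \<le> n" by (simp only: of_nat_le_iff)
        show "(15 / 16) ^ n / 16 \<le> \<mu> / (8 * real p)"
          using p'(4) t0 p0 unfolding t_def[symmetric] by (simp add: field_simps)
        have "8 * real (3 * m + 1) ^ 2 * ln (real n) \<le> 8 * (3 * x + 1) ^ 2 * ln (real n)"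
          using sq n by (intro mult_right_mono) auto
        then show "6 * real n / 25 + 11 + 8 * real (3 * m + 1) ^ 2 * ln (real n) \<le> real e"
          using E(2) e(4) by linarith
      qed (rule p'(3))
      then have "real (card {w. length w = n \<and> set w \<subseteq> {0..<int p} \<and> sign_prob (int p) w \<ge> \<mu> / (8 * real p)}) * (3 * \<mu> / real p) ^ (n - 1)
        \<le> 2 ^ n * real p ^ e * (16 * real p / (real (m + 1) * \<mu>)) ^ (n - e) * (3 * \<mu> / real p) ^ (n - 1)"
        using \<mu> p0 by (intro mult_right_mono) auto
      also have "\<dots> \<le> Cb" unfolding Cb_def
        using p0 p'(4) e \<mu> t0 by (intro weak_level_single_le) auto
      finally show "real (card {w. length w = n \<and> set w \<subseteq> {0..<int p} \<and> sign_prob (int p) w \<ge> \<mu> / (8 * real p)}) * (3 * \<mu> / real p) ^ (n - 1) \<le> Cb" .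
    qed (use finPSb in auto)
    have "card PSb \<le> card {1..nat \<lfloor>2 * \<mu> / t\<rfloor>}" using subPSb by (intro card_mono) auto
    then have "real (card PSb) \<le> real (nat \<lfloor>2 * \<mu> / t\<rfloor>)" unfolding of_nat_le_iff by simp
    also have "\<dots> \<le> 2 * \<mu> / t" using \<mu> t0 by (intro of_nat_floor) auto
    finally have "real (card PSb) * Cb \<le> 2 * \<mu> / t * Cb"
      using \<mu> t0 by (intro mult_right_mono) (auto simp: Cb_def)
    also have "\<dots> \<le> t"
      unfolding Cb_def \<mu>_def t_def
      by (rule weak_level_total_le) (use n e m(2) E(8) in \<open>auto simp: x_def\<close>)
    finally have sum_b: "(\<Sum>(p, w)\<in>Tb. sign_prob p w ^ (n - 1)) \<le> t" using Tb by linarith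

    have main: "real (card {R \<in> {..<n} \<rightarrow>\<^sub>E signs n. dependent_rows n R}) \<le>
       2 ^ (n * n) * (real n * (t + (\<Sum>(p, w)\<in>Ta \<union> Tb. sign_prob p w ^ (n - 1))))"
    proof (rule card_dependent_rows_le)
      show "length w = n" if "(p, w) \<in> Ta \<union> Tb" for p w using that by (auto simp: Ta_def Tb_def)
      fix v :: "int list"
      assume len: "length v = n" and v: "\<exists>x\<in>set v. x \<noteq> 0" "\<forall>x\<in>set v. \<bar>x\<bar> \<le> (2 * int n + 1) ^ n" "t < sign_prob 0 v"
      note nl = len[symmetric]
      have "\<exists>p. prime p \<and> odd p \<and>
        (length v ^ 2 < 8 * p \<and> p \<le> length v ^ 2 \<and> 2 / real (m + 1) \<le> sign_prob (int p) v \<and> sign_prob (int p) v \<le> 3 / 5 \<or>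
         \<mu> / (8 * real p) \<le> 2 / real (m + 1) \<and> real p \<le> 2 * \<mu> / t \<and> \<mu> / (8 * real p) \<le> sign_prob (int p) v \<and> sign_prob (int p) v \<le> 3 * \<mu> / real p)"
        by (rule cover_by_primes[where Nmin = N0 and t = t]) (use v n t0 N0 \<mu> E(3,4) nn len in auto)
      then obtain p where p: "prime p" "odd p"
         "n ^ 2 < 8 * p \<and> p \<le> n ^ 2 \<and> 2 / real (m + 1) \<le> sign_prob (int p) v \<and> sign_prob (int p) v \<le> 3 / 5 \<or>
         \<mu> / (8 * real p) \<le> 2 / real (m + 1) \<and> real p \<le> 2 * \<mu> / t \<and> \<mu> / (8 * real p) \<le> sign_prob (int p) v \<and> sign_prob (int p) v \<le> 3 * \<mu> / real p"
        using len by auto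
      have p0: "int p > 0" using p(1) by (simp add: prime_gt_0_nat)
      have "set (map (\<lambda>x. x mod int p) v) \<subseteq> {0..<int p}" using p0 by auto
      then have "(int p, map (\<lambda>x. x mod int p) v) \<in> Ta \<union> Tb"
        using p len unfolding Ta_def Tb_def PSa_def PSb_def by (auto simp: sign_prob_mod)
      then show "\<exists>p. (p, map (\<lambda>x. x mod p) v) \<in> Ta \<union> Tb" by blast
    qed (use n t0 Ta Tb in auto)
    have "(\<Sum>(p, w)\<in>Ta \<union> Tb. sign_prob p w ^ (n - 1)) \<le> t + t"
    proof -
      \<comment> \<open>The two families may overlap; the nonnegative sum over the overlap is
        dropped.\<close>
      have "(\<Sum>(p, w)\<in>Ta \<inter> Tb. sign_prob p w ^ (n - 1)) \<ge> 0"
        by (intro sum_nonneg) (auto simp: sign_prob_nonneg)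
      then show ?thesis
        using Ta Tb sum_a sum_b sum.union_inter[of Ta Tb "\<lambda>(p, w). sign_prob p w ^ (n - 1)"] by linarith
    qed
    \<comment> \<open>One \<open>t\<close> accounts for kernel vectors that are not concentrated,
      one for each of the two families.\<close>
    then have "2 ^ (n * n) * (real n * (t + (\<Sum>(p, w)\<in>Ta \<union> Tb. sign_prob p w ^ (n - 1)))) \<le> 2 ^ (n * n) * (real n * (t + (t + t)))"
      by (intro mult_left_mono add_left_mono) auto
    also have "\<dots> = 2 ^ (n * n) * (3 * real n * (15 / 16) ^ n)" by (simp add: t_def)
    finally show ?case using main by linarith
  qed
qed

section \<open>The singularity probability\<close>

text \<open>Any base above \<open>15 / 16\<close> absorbs the factor \<open>3 * n\<close>.\<close>

lemma eventually_measure_det_zero_le: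
  assumes "\<And>n. random_sign_matrix (\<Omega> n) n (M n)" and c: "15 / 16 < c"
  shows "\<forall>\<^sub>F n in sequentially. measure (\<Omega> n) {\<omega> \<in> space (\<Omega> n). Determinant.det (M n \<omega>) = 0} \<le> c ^ n"
proof -
  have "(\<lambda>n. real n * (15 / (16 * c)) ^ n) \<longlonglongrightarrow> 0"
    using c by (intro powser_times_n_limit_0) (auto simp: field_simps)
  then have "\<forall>\<^sub>F n in sequentially. real n * (15 / (16 * c)) ^ n < 1 / 3"
    by (rule order_tendstoD(2)) simp
  then show ?thesis using eventually_card_dependent_rows_le eventually_ge_at_top[of 1]
  proof eventually_elim
    case (elim n)
    have "measure (\<Omega> n) {\<omega> \<in> space (\<Omega> n). Determinant.det (M n \<omega>) = 0}
      \<le> real (card {R \<in> {..<n} \<rightarrow>\<^sub>E signs n. dependent_rows n R}) / 2 ^ (n * n)"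
      using assms(1) elim(3) by (rule measure_det_zero_le)
    also have "\<dots> \<le> 3 * real n * (15 / 16) ^ n"
      using elim(2) by (simp add: field_simps)
    also have "(15 / 16 :: real) ^ n = (15 / (16 * c)) ^ n * c ^ n"
      using c by (simp flip: power_mult_distrib)
    also have "3 * real n * ((15 / (16 * c)) ^ n * c ^ n) = 3 * (real n * (15 / (16 * c)) ^ n) * c ^ n"
      by simp
    also have "\<dots> \<le> 1 * c ^ n"
      using elim(1) c by (intro mult_right_mono) auto
    finally show ?case by simp
  qed
qed

theorem theorem1p5:
  fixes \<Omega> :: "nat \<Rightarrow> 'a measure" and M :: "nat \<Rightarrow> 'a \<Rightarrow> real mat"
  assumes "\<And>n. random_sign_matrix (\<Omega> n) n (M n)"
  shows "(\<exists>!\<epsilon>. solves_entropy_equation \<epsilon>) \<and>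
    (\<forall>\<epsilon>. solves_entropy_equation \<epsilon> \<longrightarrow>
      0.06191 \<le> \<epsilon> \<and> \<epsilon> < 0.06192 \<and>
      (\<exists>\<delta> :: nat \<Rightarrow> real. \<delta> \<longlonglongrightarrow> 0 \<and>
        (\<forall>n. measure (\<Omega> n) {\<omega> \<in> space (\<Omega> n). Determinant.det (M n \<omega>) = 0}
              \<le> (1 - \<epsilon> + \<delta> n) ^ n)))"
proof (intro conjI allI impI)
  show "\<exists>!\<epsilon>. solves_entropy_equation \<epsilon>" by (rule solves_entropy_equation_ex1)
  fix \<epsilon> assume "solves_entropy_equation \<epsilon>"
  then have \<epsilon>: "6191 / 100000 < \<epsilon>" "\<epsilon> < 6192 / 100000"
    using solves_entropy_equation_bounds by auto
  then show "0.06191 \<le> \<epsilon>" "\<epsilon> < 0.06192" by auto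
  define P where "P n = measure (\<Omega> n) {\<omega> \<in> space (\<Omega> n). Determinant.det (M n \<omega>) = 0}" for n
  have "\<forall>\<^sub>F n in sequentially. P n \<le> (1 - \<epsilon>) ^ n"
    unfolding P_def using assms \<epsilon> by (intro eventually_measure_det_zero_le) auto
  then obtain n0 where n0: "\<And>n. n \<ge> n0 \<Longrightarrow> P n \<le> (1 - \<epsilon>) ^ n"
    unfolding eventually_sequentially by blast
  \<comment> \<open>For the finitely many small \<open>n\<close> the value \<open>\<epsilon>\<close>
    makes the base 1, and the claim is that a probability is at most 1.\<close>
  define \<delta> :: "nat \<Rightarrow> real" where "\<delta> n = (if n \<ge> n0 then 0 else \<epsilon>)" for n
  have "\<forall>\<^sub>F n in sequentially. \<delta> n = 0"
    using eventually_ge_at_top[of n0] by eventually_elim (simp add: \<delta>_def)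
  then have "\<delta> \<longlonglongrightarrow> 0" by (rule tendsto_eventually)
  moreover have "P n \<le> (1 - \<epsilon> + \<delta> n) ^ n" for n
  proof (cases "n \<ge> n0")
    case False
    have "prob_space (\<Omega> n)" using assms by (simp add: random_sign_matrix_def)
    then show ?thesis using False prob_space.prob_le_1 by (simp add: P_def \<delta>_def)
  qed (simp add: n0 \<delta>_def)
  ultimately show "\<exists>\<delta>. \<delta> \<longlonglongrightarrow> 0 \<and>
      (\<forall>n. measure (\<Omega> n) {\<omega> \<in> space (\<Omega> n). Determinant.det (M n \<omega>) = 0} \<le> (1 - \<epsilon> + \<delta> n) ^ n)"
    unfolding P_def by blast
qed

end
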